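(* Let $\Omega\subset\mathbb{C}^n$ be a bounded starlike circular domain containing $0$ whose Minkowski functional $\rho$ is $C^1$ except on some lower-dimensional manifolds $E\subset\mathbb{C}^n$. Let $k\geq 1$ be an integer, let $f:\Omega\to\mathbb{C}$ be holomorphic, and suppose that the mapping $F(z)=z f(z)$ belongs to $\mathcal{S}^*(\Omega)$. If $F(z)-z$ has a zero of order $k+1$ at $z=0$, then for every $z\in\Omega\setminus E$, $$ \left\vert \left(2\frac{\partial\rho(z)}{\partial z}\frac{D^{2k+1}F(0)(z^{2k+1})}{(2k+1)!\,\rho^{2k+1}(z)}\right)^2 - \left(2\frac{\partial\rho(z)}{\partial z}\frac{D^{k+1}F(0)(z^{k+1})}{(k+1)!\,\rho^{k+1}(z)}\right)^2 \right\vert \leq \frac{(k+2)^2}{k^4}+\frac{4}{k^2}. $$ The estimate is sharp: for every such $\Omega$ and $k$, the right-hand side cannot be replaced by any smaller constant (valid for all $F$ satisfying the hypotheses and all $z\in\Omega\setminus E$).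
   Context: A bounded starlike circular domain $\Omega\subset\mathbb{C}^n$ is a bounded domain for which there is a (unique) continuous function $\rho:\mathbb{C}^n\to\mathbb{R}$, its Minkowski functional, with $\rho(z)\ge0$ and $\rho(z)=0\Leftrightarrow z=0$; $\rho(tz)=|t|\rho(z)$ for $t\in\mathbb{C}$, $z\in\mathbb{C}^n$; and $\Omega=\{z\in\mathbb{C}^n:\rho(z)<1\}$. "$\rho$ is $C^1$ except on lower-dimensional manifolds $E$" means that $\rho$ is continuously differentiable on $\mathbb{C}^n\setminus E$, where $E$ consists of manifolds of real dimension less than $2n$ (necessarily $0\in E$). Write $\frac{\partial\rho(z)}{\partial z}=\left(\frac{\partial\rho(z)}{\partial z_1},\dots,\frac{\partial\rho(z)}{\partial z_n}\right)$ (Wirtinger derivatives, a row vector, multiplied with column vectors of $\mathbb{C}^n$), and $\rho^m(z)=(\rho(z))^m$. For holomorphic $F:\Omega\to\mathbb{C}^n$, $D^mF(0)$ is the $m$-th Fréchet derivative at $0$ (a symmetric $m$-linear mapping) and $D^mF(0)(z^m)=D^mF(0)(z,\dots,z)$ ($m$ times). $F$ is normalized if $F(0)=0$ and $DF(0)=I$, and locally biholomorphic if $DF(z)$ is invertible for each $z\in\Omega$. The class $\mathcal{S}^*(\Omega)$ of starlike mappings on $\Omega$ consists of all normalized locally biholomorphic $F:\Omega\to\mathbb{C}^n$ such that $\operatorname{Re}\left(\frac{\partial\rho(z)}{\partial z}(DF(z))^{-1}F(z)\right)>0$ for all $z\in\Omega\setminus E$. A holomorphic mapping $g:\Omega\to\mathbb{C}^n$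 has a zero of order $m$ at $z=0$ ($m\in\mathbb{N}$) if $g(0)=0$, $Dg(0)=0,\dots,D^{m-1}g(0)=0$ and $D^mg(0)\neq0$. *)

theory Defs
  imports "HOL-Analysis.Analysis"
begin

definition starlike_circular_domain ::
    "(complex^'n) set \<Rightarrow> (complex^'n \<Rightarrow> real) \<Rightarrow> bool" where
  "starlike_circular_domain \<Omega> \<rho> \<longleftrightarrow>
     open \<Omega> \<and> connected \<Omega> \<and> \<Omega> \<noteq> {} \<and> bounded \<Omega> \<and>
     continuous_on UNIV \<rho> \<and>
     (\<forall>z. \<rho> z \<ge> 0) \<and> (\<forall>z. \<rho> z = 0 \<longleftrightarrow> z = 0) \<and>
     (\<forall>t z. \<rho> (t *s z) = cmod t * \<rho> z) \<and>
     \<Omega> = {z. \<rho> z < 1}"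

text \<open>
  A manifold carries the subspace topology; the model space \<open>\<real>\<^sup>d\<close> is represented by
  a \<open>d\<close>-dimensional real subspace of the ambient space, which exists for every
  \<open>d \<le> DIM('a)\<close>. No smoothness is demanded, so smooth submanifolds are included.
\<close>

definition manifold_of_dim :: "nat \<Rightarrow> 'a::euclidean_space set \<Rightarrow> bool" where
  "manifold_of_dim d M \<longleftrightarrow>
     (\<forall>p\<in>M. \<exists>U (S :: 'a set) V. p \<in> U \<and> openin (top_of_set M) U \<and>
        subspace S \<and> dim S = d \<and> openin (top_of_set S) V \<and> U homeomorphic V)"

text \<open>
  Countability of the family is essential: every set is the union of its
  (\<open>0\<close>-dimensional) points. The real dimension of \<open>complex^'n\<close> is \<open>2 * CARD('n)\<close>.
\<close>

definition lower_dim_manifolds :: "(complex^'n) set \<Rightarrow> bool" where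
  "lower_dim_manifolds E \<longleftrightarrow>
     (\<exists>\<M>. countable \<M> \<and> E = \<Union>\<M> \<and>
        (\<forall>M\<in>\<M>. \<exists>d < 2 * CARD('n). manifold_of_dim d M))"

definition C1_on :: "('a::real_normed_vector \<Rightarrow> real) \<Rightarrow> 'a set \<Rightarrow> bool" where
  "C1_on \<rho> S \<longleftrightarrow>
     (\<exists>\<rho>' :: 'a \<Rightarrow> 'a \<Rightarrow>\<^sub>L real.
        (\<forall>z\<in>S. (\<rho> has_derivative blinfun_apply (\<rho>' z)) (at z)) \<and> continuous_on S \<rho>')"

text \<open>Wirtinger gradient: \<open>\<partial>/\<partial>z\<^sub>j = (\<partial>/\<partial>x\<^sub>j - \<i> \<partial>/\<partial>y\<^sub>j) / 2\<close>.\<close>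

definition wirtinger :: "(complex^'n \<Rightarrow> real) \<Rightarrow> complex^'n \<Rightarrow> complex^'n" where
  "wirtinger \<rho> z =
     (\<chi> j. (complex_of_real (frechet_derivative \<rho> (at z) (axis j 1))
            - \<i> * complex_of_real (frechet_derivative \<rho> (at z) (axis j \<i>))) / 2)"

text \<open>
  Holomorphy as Frechet differentiability with complex-linear derivative; \<open>s\<close> is the
  complex scalar multiplication of the target (\<open>(*)\<close> or \<open>(*s)\<close>).
\<close>

definition holo_on ::
    "(complex \<Rightarrow> 'b \<Rightarrow> 'b) \<Rightarrow> (complex^'n \<Rightarrow> 'b::real_normed_vector) \<Rightarrow> (complex^'n) set \<Rightarrow> bool" where
  "holo_on s f \<Omega> \<longleftrightarrow>
     (\<forall>z\<in>\<Omega>. \<exists>f'. (f has_derivative f') (at z) \<and> (\<forall>c v. f' (c *s v) = s c (f' v)))"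

text \<open>
  \<open>higher_deriv F [h\<^sub>1, \<dots>, h\<^sub>m] z\<close> is \<open>D\<^sup>mF(z)(h\<^sub>1, \<dots>, h\<^sub>m)\<close>, obtained by differentiating
  \<open>y \<mapsto> D\<^sup>m\<^sup>-\<^sup>1F(y)(h\<^sub>2, \<dots>, h\<^sub>m)\<close> at \<open>z\<close> in direction \<open>h\<^sub>1\<close>.
\<close>

primrec higher_deriv ::
    "('a::real_normed_vector \<Rightarrow> 'b::real_normed_vector) \<Rightarrow> 'a list \<Rightarrow> 'a \<Rightarrow> 'b" where
  "higher_deriv F [] z = F z"
| "higher_deriv F (h # hs) z = frechet_derivative (\<lambda>y. higher_deriv F hs y) (at z) h"

definition zero_of_order ::
    "nat \<Rightarrow> ('a::real_normed_vector \<Rightarrow> 'b::real_normed_vector) \<Rightarrow> bool" where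
  "zero_of_order m g \<longleftrightarrow>
     (\<forall>j<m. \<forall>hs. length hs = j \<longrightarrow> higher_deriv g hs 0 = 0) \<and>
     (\<exists>hs. length hs = m \<and> higher_deriv g hs 0 \<noteq> 0)"

definition starlike_mappings ::
    "(complex^'n) set \<Rightarrow> (complex^'n \<Rightarrow> real) \<Rightarrow> (complex^'n) set \<Rightarrow> (complex^'n \<Rightarrow> complex^'n) set" where
  "starlike_mappings \<Omega> \<rho> E =
     {F. holo_on (*s) F \<Omega> \<and>
         F 0 = 0 \<and> frechet_derivative F (at 0) = id \<and>
         (\<forall>z\<in>\<Omega>. bij (frechet_derivative F (at z))) \<and>
         (\<forall>z\<in>\<Omega> - E.
            Re (scalar_product (wirtinger \<rho> z) (inv (frechet_derivative F (at z)) (F z))) > 0)}"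

definition normalized_coeff ::
    "(complex^'n \<Rightarrow> real) \<Rightarrow> (complex^'n \<Rightarrow> complex^'n) \<Rightarrow> nat \<Rightarrow> complex^'n \<Rightarrow> complex" where
  "normalized_coeff \<rho> F m z =
     2 * scalar_product (wirtinger \<rho> z) (higher_deriv F (replicate m z) 0)
       / (fact m * complex_of_real (\<rho> z) ^ m)"

end

theory Submission
  imports Defs "HOL-Complex_Analysis.Complex_Analysis"
begin

text \<open>
  For \<open>F(z) = z f(z)\<close> one has \<open>DF(z)\<inverse> F(z) = p(z) z\<close> with \<open>p = f / (f + Df(z) z)\<close>, and homogeneity of
  \<open>\<rho>\<close> gives \<open>2 (\<partial>\<rho>/\<partial>z) z = \<rho>(z)\<close>. Hence starlikeness means \<open>Re p > 0\<close> off \<open>E\<close>, and \<open>Re p \<ge> 0\<close> on the whole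
  domain because the complement of \<open>E\<close> is dense (invariance of domain and Baire). On the slice
  \<open>g(\<zeta>) = f(\<zeta> z / \<rho>(z))\<close> the quantities to be estimated are Taylor coefficients of \<open>g\<close>, and
  \<open>q = 1 + \<zeta> g'/g = 1/p\<close> is a Caratheodory function, whose coefficients have modulus at most \<open>2\<close>;
  comparing coefficients gives \<open>k g\<^sub>k = q\<^sub>k\<close> and \<open>2k g\<^sub>2\<^sub>k = q\<^sub>2\<^sub>k + q\<^sub>k g\<^sub>k\<close>, and the triangle inequality
  finishes the estimate. Equality is approached by \<open>f(z) = (1 - \<i> \<ell>(z)\<^sup>k)\<close> to the power \<open>-2/k\<close>, where
  \<open>\<ell>\<close> is a linear form with \<open>|\<ell>| \<le> \<rho>\<close> and equality at some \<open>u\<close>: the factor \<open>\<i>\<close> gives the two squares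
  opposite signs, and points outside \<open>E\<close> near \<open>u/2\<close> suffice.
\<close>

no_notation fps_nth (infixl "$" 75)

section \<open>Holomorphic functions of one variable\<close>

lemma cmod_le_of_rotations:
  assumes "\<And>\<omega>. cmod \<omega> = 1 \<Longrightarrow> 0 \<le> Re (of_real B + \<omega> * c)" and "0 \<le> B"
  shows "cmod c \<le> B"
proof (cases "c = 0")
  case False
  define \<omega> where "\<omega> = - cnj c / cmod c"
  have "cmod \<omega> = 1" using False by (simp add: \<omega>_def norm_divide)
  have "\<omega> * c = - of_real (cmod c)"
    using False by (simp add: \<omega>_def field_simps complex_norm_square[symmetric] power2_eq_square)
  with assms(1)[OF \<open>cmod \<omega> = 1\<close>] show ?thesis by simp
qed (use assms in auto)

text \<open>
  The proof integrates \<open>q(\<zeta>) (2 + 2 Re (\<omega> (r/\<zeta>)\<^sup>n)) d\<zeta>/\<zeta>\<close> over the circle of radius \<open>r\<close>: the kernel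
  is nonnegative, and by Cauchy's formula the result is \<open>2\<pi>\<i> (2 + \<omega> q\<^sub>n r\<^sup>n)\<close>.
\<close>

lemma Caratheodory_coeff_bound:
  assumes hol: "q holomorphic_on ball 0 1" and q0: "q 0 = 1" and n: "n \<ge> 1"
    and Re: "\<And>\<zeta>. \<zeta> \<in> ball 0 1 \<Longrightarrow> Re (q \<zeta>) \<ge> 0"
  shows "cmod ((deriv ^^ n) q 0 / fact n) \<le> 2"
proof -
  define c where "c = (deriv ^^ n) q 0 / fact n"
  have key: "cmod (c * r ^ n) \<le> 2" if r: "0 < r" "r < 1" for r :: real
  proof (rule cmod_le_of_rotations)
    fix \<omega> :: complex assume \<omega>: "cmod \<omega> = 1"
    have cont: "continuous_on (cball 0 r) q"
      using r by (intro holomorphic_on_imp_continuous_on holomorphic_on_subset[OF hol]) auto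
    have holr: "q holomorphic_on ball 0 r"
      using r by (intro holomorphic_on_subset[OF hol]) auto
    have 0: "0 \<in> ball (0::complex) r" using r by simp
    have i1: "((\<lambda>u. q u / u ^ Suc 0) has_contour_integral (2*pi*\<i>)) (circlepath 0 r)"
      using Cauchy_has_contour_integral_higher_derivative_circlepath[OF cont holr 0, of 0] q0 by simp
    have i2: "((\<lambda>u. q u / u ^ Suc n) has_contour_integral (2*pi*\<i>*c)) (circlepath 0 r)"
      using Cauchy_has_contour_integral_higher_derivative_circlepath[OF cont holr 0, of n]
      by (simp add: c_def mult_ac)
    have i3: "((\<lambda>u. q u * u ^ (n-1)) has_contour_integral 0) (circlepath 0 r)"
    proof (rule Cauchy_theorem_convex_simple)
      show "(\<lambda>u. q u * u ^ (n-1)) holomorphic_on ball 0 1"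
        by (intro holomorphic_intros hol)
      show "path_image (circlepath 0 r) \<subseteq> ball 0 1" using r by auto
    qed auto
    let ?F = "\<lambda>u. 2 * (q u / u ^ Suc 0) + (\<omega> * r^n) * (q u / u ^ Suc n)
          + (cnj \<omega> / r^n) * (q u * u ^ (n-1))"
    have "(?F has_contour_integral (2 * (2*pi*\<i>) + (\<omega> * r^n) * (2*pi*\<i>*c) + (cnj \<omega> / r^n) * 0))
       (circlepath 0 r)"
      by (intro has_contour_integral_add has_contour_integral_lmul i1 i2 i3)
    then have "((\<lambda>t. ?F (0 + r * cis t) * r * \<i> * cis t) has_integral
         (2 * (2*pi*\<i>) + (\<omega> * r^n) * (2*pi*\<i>*c))) {0..2*pi}"
      unfolding circlepath_def by (subst (asm) has_contour_integral_part_circlepath_iff) auto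
    from has_integral_mult_right[OF this, of "1/(2*pi*\<i>)"]
    moreover have "1/(2*pi*\<i>) * (2 * (2*pi*\<i>) + (\<omega> * r^n) * (2*pi*\<i>*c)) = 2 + \<omega> * (c * r ^ n)"
      by (simp add: field_simps)
    ultimately have I: "((\<lambda>t. 1/(2*pi*\<i>) * (?F (0 + r * cis t) * r * \<i> * cis t)) has_integral
         (2 + \<omega> * (c * r ^ n))) {0..2*pi}"
      by (simp only:)
    have eq: "1/(2*pi*\<i>) * (?F (0 + r * cis t) * r * \<i> * cis t)
        = q (r * cis t) * of_real ((2 + 2 * Re (\<omega> * cis (-(n*t)))) / (2*pi))" for t :: real
    proof -
      define e where "e = cis t"
      have e: "e \<noteq> 0" by (simp add: e_def)
      have "cis (-(n*t)) = 1 / e^n"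
        by (simp only: e_def Complex.DeMoivre cis_inverse[symmetric] inverse_eq_divide)
      moreover have "of_real (2 * Re (\<omega> * cis (-(n*t)))) = \<omega> * cis (-(n*t)) + cnj \<omega> * cis (n*t)"
        unfolding complex_add_cnj[symmetric] by (simp add: cis_cnj)
      moreover have "cis (n*t) = e^n" by (simp add: e_def Complex.DeMoivre)
      ultimately have "of_real ((2 + 2 * Re (\<omega> * cis (-(n*t)))) / (2*pi))
         = (2 + \<omega> * (1/e^n) + cnj \<omega> * e^n) / (2 * of_real pi)" by simp
      moreover have "e * e^(n-1) = e^n" "complex_of_real r * of_real r^(n-1) = of_real r ^ n"
        using n by (auto simp: power_eq_if)
      moreover have "1/(2*pi*\<i>) * (?F (0 + r * e) * r * \<i> * e) =
         q (r * e) * (2 + \<omega> * (1/e^n) + cnj \<omega> * ((r * r^(n-1)) / r^n) * (e * e^(n-1)))/ (2 * of_real pi)"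
        using r e by (simp add: field_simps power_mult_distrib)
      ultimately show ?thesis using r by (simp add: e_def)
    qed
    have "0 \<le> Re (2 + \<omega> * (c * r ^ n))"
    proof (rule has_integral_nonneg[OF has_integral_Re[OF I]])
      fix t assume "t \<in> {0..2*pi}"
      have "\<bar>Re (\<omega> * cis (-(n*t)))\<bar> \<le> 1"
        using abs_Re_le_cmod[of "\<omega> * cis (-(n*t))"] \<omega> by (simp add: norm_mult)
      moreover have "0 \<le> Re (q (r * cis t))" using r by (intro Re) (simp add: norm_mult)
      ultimately show "0 \<le> Re (1/(2*pi*\<i>) * (?F (0 + r * cis t) * r * \<i> * cis t))"
        unfolding eq by (auto intro!: mult_nonneg_nonneg)
    qed
    then show "0 \<le> Re (of_real 2 + \<omega> * (c * r ^ n))" by simp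
  qed auto
  have "((\<lambda>r. cmod (c * of_real (r ^ n))) \<longlongrightarrow> cmod (c * of_real (1 ^ n))) (at_left 1)"
    by (intro tendsto_intros)
  moreover have "\<forall>\<^sub>F r in at_left 1. cmod (c * of_real (r ^ n)) \<le> 2"
    using eventually_at_left_real[OF zero_less_one] by (rule eventually_mono[OF _ key]) auto
  ultimately have "cmod (c * of_real (1 ^ n)) \<le> 2"
    by (intro tendsto_upperbound) auto
  then show ?thesis by (simp add: c_def)
qed

lemma holomorphic_Taylor2:
  assumes hol: "\<psi> holomorphic_on ball 0 2" and bd: "\<And>t. t \<in> ball 0 2 \<Longrightarrow> cmod (\<psi> t) \<le> M"
    and t: "cmod t \<le> 1"
  shows "cmod (\<psi> t - \<psi> 0 - t * deriv \<psi> 0) \<le> 8 * M * (cmod t)\<^sup>2"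
proof -
  have "cmod (\<psi> t - (\<Sum>i\<le>1. (deriv ^^ i) \<psi> 0 * (t - 0) ^ i / fact i)) \<le> 8 * M * cmod (t - 0) ^ Suc 1 / fact 1"
  proof (rule complex_Taylor[of "cball 0 1" 1 "\<lambda>i. (deriv ^^ i) \<psi>", simplified funpow_0])
    fix i x assume x: "x \<in> cball (0::complex) 1"
    then have x2: "x \<in> ball 0 2" by auto
    have "(deriv ^^ i) \<psi> holomorphic_on ball 0 2"
      by (intro holomorphic_higher_deriv hol) auto
    then show "((deriv ^^ i) \<psi> has_field_derivative (deriv ^^ Suc i) \<psi> x) (at x within cball 0 1)"
      using holomorphic_derivI[OF _ open_ball x2] by simp
  next
    fix x assume x: "x \<in> cball (0::complex) 1"
    have sub: "cball x (1/2) \<subseteq> ball 0 2"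
    proof
      fix w assume "w \<in> cball x (1/2)"
      then have "dist x w \<le> 1/2" by simp
      then show "w \<in> ball 0 2" using dist_triangle[of 0 w x] x by simp
    qed
    have "cmod ((deriv ^^ 2) \<psi> x) \<le> fact 2 * M / (1/2)^2"
    proof (rule Cauchy_inequality)
      show "\<psi> holomorphic_on ball x (1/2)"
        using hol sub holomorphic_on_subset ball_subset_cball by blast
      show "continuous_on (cball x (1/2)) \<psi>"
        using hol sub holomorphic_on_imp_continuous_on holomorphic_on_subset by blast
      show "cmod (\<psi> w) \<le> M" if "cmod (x - w) = 1/2" for w
        using sub that by (intro bd) (auto simp: dist_norm subset_iff)
    qed auto
    then show "cmod ((deriv ^^ Suc 1) \<psi> x) \<le> 8 * M"
      by (simp add: numeral_2_eq_2 power2_eq_square)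
  qed (use t in auto)
  then show ?thesis by (simp add: algebra_simps power2_eq_square)
qed

lemma log_derivative_coeffs:
  assumes g: "g holomorphic_on ball 0 1" and q: "q holomorphic_on ball 0 1"
    and ode: "\<And>\<zeta>. \<zeta> \<in> ball 0 1 \<Longrightarrow> \<zeta> * deriv g \<zeta> = (q \<zeta> - 1) * g \<zeta>"
    and g0: "g 0 = 1" and k: "k \<ge> 1"
    and van: "\<And>j. 1 \<le> j \<Longrightarrow> j < k \<Longrightarrow> (deriv ^^ j) g 0 = 0"
  shows "of_nat k * ((deriv ^^ k) g 0 / fact k) = (deriv ^^ k) q 0 / fact k"
    and "of_nat (2 * k) * ((deriv ^^ (2 * k)) g 0 / fact (2 * k)) =
      (deriv ^^ (2 * k)) q 0 / fact (2 * k) + (deriv ^^ k) q 0 / fact k * ((deriv ^^ k) g 0 / fact k)"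
proof -
  define G where "G = fps_expansion g 0"
  define Q where "Q = fps_expansion q 0 - 1"
  have G: "g has_fps_expansion G" and Q: "(\<lambda>\<zeta>. q \<zeta> - 1) has_fps_expansion Q"
    unfolding G_def Q_def using g q
    by (auto intro!: fps_expansion_intros has_fps_expansion_fps_expansion[of "ball 0 1"])
  have "(\<lambda>\<zeta>. \<zeta> * deriv g \<zeta>) has_fps_expansion fps_X * fps_deriv G"
    by (intro fps_expansion_intros has_fps_expansion_deriv G)
  moreover have "(\<lambda>\<zeta>. \<zeta> * deriv g \<zeta>) has_fps_expansion Q * G"
  proof -
    have "(\<lambda>\<zeta>. (q \<zeta> - 1) * g \<zeta>) has_fps_expansion Q * G"
      by (intro fps_expansion_intros G Q)
    moreover have "\<forall>\<^sub>F \<zeta> in nhds 0. (q \<zeta> - 1) * g \<zeta> = \<zeta> * deriv g \<zeta>"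
      using eventually_nhds_in_open[of "ball 0 1" "0::complex"] by (auto elim!: eventually_mono simp: ode)
    ultimately show ?thesis by (rule iffD1[OF has_fps_expansion_cong[OF _ refl], rotated])
  qed
  ultimately have eq: "fps_X * fps_deriv G = Q * G" by (rule fps_expansion_unique_complex)
  have "fps_nth (fps_X * fps_deriv G) n = of_nat n * fps_nth G n" for n
    by (cases n) simp_all
  then have rec: "of_nat n * fps_nth G n = (\<Sum>i=0..n. fps_nth Q i * fps_nth G (n - i))" for n
    using arg_cong[OF eq, of "\<lambda>F. fps_nth F n"] by (simp only: fps_mult_nth[of Q G])
  have Gn: "fps_nth G n = (deriv ^^ n) g 0 / fact n" for n
    by (simp add: G_def fps_expansion_def)
  have Qn: "fps_nth Q n = (deriv ^^ n) q 0 / fact n" if "n \<ge> 1" for n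
    using that by (simp add: Q_def fps_expansion_def)
  have G0: "fps_nth G 0 = 1" using g0 Gn by simp
  have Gj: "fps_nth G j = 0" if "1 \<le> j" "j < k" for j using van that Gn by simp
  have Q0: "fps_nth Q 0 = 0" using rec[of 0] G0 by simp
  have Qj: "fps_nth Q j = of_nat j * fps_nth G j" if "1 \<le> j" "j \<le> k" for j
  proof -
    have "(\<Sum>i=0..j. fps_nth Q i * fps_nth G (j - i)) = (\<Sum>i=0..j. if i = j then fps_nth Q j else 0)"
    proof (intro sum.cong refl)
      fix i assume i: "i \<in> {0..j}"
      have "i = 0 \<or> i = j \<or> 1 \<le> j - i \<and> j - i < k"
        using i that unfolding atLeastAtMost_iff by arith
      then show "fps_nth Q i * fps_nth G (j - i) = (if i = j then fps_nth Q j else 0)"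
        using Q0 Gj[of "j - i"] Gj[of j] G0 that by auto
    qed
    then show ?thesis using rec[of j] by simp
  qed
  show "of_nat k * ((deriv ^^ k) g 0 / fact k) = (deriv ^^ k) q 0 / fact k"
    using Qj[of k] k Gn Qn by simp
  have "(\<Sum>i=0..2 * k. fps_nth Q i * fps_nth G (2 * k - i))
      = (\<Sum>i=0..2 * k. (if i = 2 * k then fps_nth Q (2 * k) else 0) + (if i = k then fps_nth Q k * fps_nth G k else 0))"
  proof (intro sum.cong refl)
    fix i assume i: "i \<in> {0..2 * k}"
    consider "i = 0" | "1 \<le> i" "i < k" | "i = k" | "i = 2 * k" | "1 \<le> 2 * k - i" "2 * k - i < k" "k < i"
      using i unfolding atLeastAtMost_iff by arith
    then show "fps_nth Q i * fps_nth G (2 * k - i)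
      = (if i = 2 * k then fps_nth Q (2 * k) else 0) + (if i = k then fps_nth Q k * fps_nth G k else 0)"
      using Q0 Gj Qj G0 k by cases auto
  qed
  then have "of_nat (2 * k) * fps_nth G (2 * k) = fps_nth Q (2 * k) + fps_nth Q k * fps_nth G k"
    unfolding rec[of "2 * k"] by (simp add: sum.distrib)
  then show "of_nat (2 * k) * ((deriv ^^ (2 * k)) g 0 / fact (2 * k)) =
      (deriv ^^ (2 * k)) q 0 / fact (2 * k) + (deriv ^^ k) q 0 / fact k * ((deriv ^^ k) g 0 / fact k)"
    using Gn[of k] Gn[of "2 * k"] Qn[of k] Qn[of "2 * k"] k by simp
qed

lemma Koebe_type_coeffs:
  assumes g: "g holomorphic_on ball 0 1" and k: "k \<ge> 1" and g0: "g 0 = 1"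
    and ode: "\<And>\<zeta>. \<zeta> \<in> ball 0 1 \<Longrightarrow> \<zeta> * deriv g \<zeta> * (1 - c * \<zeta> ^ k) = 2 * c * \<zeta> ^ k * g \<zeta>"
  shows "(deriv ^^ k) g 0 / fact k = 2 * c / of_nat k"
    and "(deriv ^^ (2 * k)) g 0 / fact (2 * k) = c\<^sup>2 * (of_nat k + 2) / (of_nat k)\<^sup>2"
proof -
  define G where "G = fps_expansion g 0"
  have G: "g has_fps_expansion G"
    unfolding G_def using g by (auto intro!: has_fps_expansion_fps_expansion[of "ball 0 1"])
  have "(\<lambda>\<zeta>. \<zeta> * deriv g \<zeta> * (1 - c * \<zeta> ^ k)) has_fps_expansion fps_X * fps_deriv G * (1 - fps_const c * fps_X ^ k)"
    by (intro fps_expansion_intros has_fps_expansion_deriv G)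
  moreover have "(\<lambda>\<zeta>. \<zeta> * deriv g \<zeta> * (1 - c * \<zeta> ^ k)) has_fps_expansion fps_const (2 * c) * fps_X ^ k * G"
  proof -
    have "(\<lambda>\<zeta>. 2 * c * \<zeta> ^ k * g \<zeta>) has_fps_expansion fps_const (2 * c) * fps_X ^ k * G"
      by (intro fps_expansion_intros G)
    moreover have "\<forall>\<^sub>F \<zeta> in nhds 0. 2 * c * \<zeta> ^ k * g \<zeta> = \<zeta> * deriv g \<zeta> * (1 - c * \<zeta> ^ k)"
      using eventually_nhds_in_open[of "ball 0 1" "0::complex"] by (auto elim!: eventually_mono simp: ode)
    ultimately show ?thesis by (rule iffD1[OF has_fps_expansion_cong[OF _ refl], rotated])
  qed
  ultimately have "fps_X * fps_deriv G * (1 - fps_const c * fps_X ^ k) = fps_const (2 * c) * fps_X ^ k * G"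
    by (rule fps_expansion_unique_complex)
  moreover have "A * (1 - fps_const c * X) = A - fps_const c * (X * A)" for A X
    by (simp add: algebra_simps)
  ultimately have eq: "fps_X * fps_deriv G - fps_const c * (fps_X ^ k * (fps_X * fps_deriv G))
      = fps_const (2 * c) * (fps_X ^ k * G)"
    by (simp only: mult.assoc)
  have Xd: "fps_nth (fps_X * fps_deriv G) n = of_nat n * fps_nth G n" for n
    by (cases n) simp_all
  have rec: "of_nat (n + k) * fps_nth G (n + k) - c * (of_nat n * fps_nth G n) = 2 * c * fps_nth G n" for n
    using arg_cong[OF eq, of "\<lambda>F. fps_nth F (n + k)"]
    by (simp add: Xd fps_X_power_mult_nth del: fps_X_mult_nth of_nat_add)
  have Gn: "fps_nth G n = (deriv ^^ n) g 0 / fact n" for n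
    by (simp add: G_def fps_expansion_def)
  have k0: "of_nat k \<noteq> (0::complex)" using k by simp
  have 1: "fps_nth G k = 2 * c / of_nat k"
    using rec[of 0] g0 k0 Gn[of 0] by (simp add: field_simps)
  have "2 * of_nat k * fps_nth G (2 * k) = c * (of_nat k + 2) * fps_nth G k"
    using rec[of k] by (simp add: mult_2[symmetric] algebra_simps)
  then have "2 * (of_nat k * of_nat k * fps_nth G (2 * k)) = 2 * (c * c * (of_nat k + 2))"
    using k0 unfolding 1 by (simp add: field_simps)
  then have "of_nat k * of_nat k * fps_nth G (2 * k) = c * c * (of_nat k + 2)"
    unfolding mult_cancel_left by simp
  then have 2: "fps_nth G (2 * k) = c\<^sup>2 * (of_nat k + 2) / (of_nat k)\<^sup>2"
    using k0 by (simp add: power2_eq_square eq_divide_eq mult_ac)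
  show "(deriv ^^ k) g 0 / fact k = 2 * c / of_nat k" using 1 Gn by simp
  show "(deriv ^^ (2 * k)) g 0 / fact (2 * k) = c\<^sup>2 * (of_nat k + 2) / (of_nat k)\<^sup>2"
    using 2 Gn by simp
qed

lemma Re_nonneg_imp_nonzero:
  assumes P: "P holomorphic_on ball 0 1" and Re: "\<And>\<zeta>. \<zeta> \<in> ball 0 1 \<Longrightarrow> Re (P \<zeta>) \<ge> 0"
    and P0: "P 0 \<noteq> 0" and \<zeta>: "\<zeta> \<in> ball 0 1"
  shows "P \<zeta> \<noteq> 0"
proof
  assume z: "P \<zeta> = 0"
  have "\<not> P constant_on ball 0 1"
  proof
    assume "P constant_on ball 0 1"
    then have "P \<zeta> = P 0" using \<zeta> unfolding constant_on_def by (metis centre_in_ball zero_less_one)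
    with z P0 show False by simp
  qed
  then have "open (P ` ball 0 1)"
    by (intro open_mapping_thm[OF P]) auto
  moreover have "0 \<in> P ` ball 0 1" using z \<zeta> by (metis imageI)
  ultimately obtain e where e: "e > 0" "cball 0 e \<subseteq> P ` ball 0 1"
    using open_contains_cball by blast
  then have "- complex_of_real e \<in> P ` ball 0 1" by (auto simp: subset_iff)
  then obtain w where "w \<in> ball 0 1" "P w = - complex_of_real e" by auto
  with Re[of w] e(1) show False by simp
qed

text \<open>
  \<open>\<zeta> g(\<zeta>)\<close> is a starlike function of the disc, so \<open>q = 1 + \<zeta> g'/g = 1/P\<close> is a Caratheodory
  function, and the coefficients of \<open>g\<close> are polynomials in those of \<open>q\<close>.
\<close>

lemma starlike_disc_coeff_bounds:
  assumes g: "g holomorphic_on ball 0 1" and g0: "g 0 = 1" and k: "k \<ge> 1"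
    and van: "\<And>j. 1 \<le> j \<Longrightarrow> j < k \<Longrightarrow> (deriv ^^ j) g 0 = 0"
    and nz: "\<And>\<zeta>. \<zeta> \<in> ball 0 1 \<Longrightarrow> g \<zeta> + \<zeta> * deriv g \<zeta> \<noteq> 0"
    and Re: "\<And>\<zeta>. \<zeta> \<in> ball 0 1 \<Longrightarrow> Re (g \<zeta> / (g \<zeta> + \<zeta> * deriv g \<zeta>)) \<ge> 0"
  shows "cmod ((deriv ^^ k) g 0 / fact k) \<le> 2 / real k"
    and "cmod ((deriv ^^ (2 * k)) g 0 / fact (2 * k)) \<le> (real k + 2) / (real k)\<^sup>2"
proof -
  define P where "P = (\<lambda>\<zeta>. g \<zeta> / (g \<zeta> + \<zeta> * deriv g \<zeta>))"
  define q where "q = (\<lambda>\<zeta>. inverse (P \<zeta>))"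
  have P: "P holomorphic_on ball 0 1"
    unfolding P_def using g nz by (intro holomorphic_intros) auto
  have Pnz: "P \<zeta> \<noteq> 0" if "\<zeta> \<in> ball 0 1" for \<zeta>
    by (rule Re_nonneg_imp_nonzero[OF P _ _ that]) (use Re g0 in \<open>auto simp: P_def\<close>)
  have q: "q holomorphic_on ball 0 1"
    unfolding q_def using P Pnz by (intro holomorphic_intros) auto
  have q0: "q 0 = 1" by (simp add: q_def P_def g0)
  have Req: "Re (q \<zeta>) \<ge> 0" if "\<zeta> \<in> ball 0 1" for \<zeta>
    using Re[OF that] by (simp add: q_def P_def[symmetric] del: inverse_divide) 
      (simp add: P_def)
  have ode: "\<zeta> * deriv g \<zeta> = (q \<zeta> - 1) * g \<zeta>" if "\<zeta> \<in> ball 0 1" for \<zeta>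
    using Pnz[OF that] nz[OF that] by (auto simp: q_def P_def field_simps)
  have k0: "real k > 0" using k by simp
  define a b c d where "a = (deriv ^^ k) g 0 / fact k" and "b = (deriv ^^ (2 * k)) g 0 / fact (2 * k)"
    and "c = (deriv ^^ k) q 0 / fact k" and "d = (deriv ^^ (2 * k)) q 0 / fact (2 * k)"
  have c: "cmod c \<le> 2" and d: "cmod d \<le> 2"
    unfolding c_def d_def using k by (auto intro!: Caratheodory_coeff_bound[OF q q0 _ Req])
  have ac: "of_nat k * a = c" and bd: "of_nat (2 * k) * b = d + c * a"
    unfolding a_def b_def c_def d_def using log_derivative_coeffs[OF g q ode g0 k van] by blast+
  have a: "cmod a \<le> 2 / real k"
    using c k0 unfolding ac[symmetric] norm_mult norm_of_nat by (simp add: field_simps)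
  then show "cmod ((deriv ^^ k) g 0 / fact k) \<le> 2 / real k" by (simp add: a_def)
  have "2 * real k * cmod b = cmod (d + c * a)"
    unfolding bd[symmetric] norm_mult norm_of_nat by simp
  also have "\<dots> \<le> cmod d + cmod c * cmod a" by (metis norm_mult norm_triangle_ineq)
  also have "\<dots> \<le> 2 + 2 * (2 / real k)" using a c d by (intro add_mono mult_mono) auto
  finally have "cmod b \<le> (real k + 2) / (real k)\<^sup>2"
    using k0 by (simp add: field_simps power2_eq_square)
  then show "cmod ((deriv ^^ (2 * k)) g 0 / fact (2 * k)) \<le> (real k + 2) / (real k)\<^sup>2"
    by (simp add: b_def)
qed

section \<open>Holomorphic functions of several variables\<close>

lemma norm_vector_scalar_mult: "norm (c *s v) = cmod c * norm v" for v :: "complex^'n"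
  by (simp add: norm_vec_def norm_mult L2_set_right_distrib)

lemma bounded_linear_vector_scalar_mult_left: "bounded_linear (\<lambda>c. c *s v)" for v :: "complex^'n"
  by (rule bounded_linear_intro[where K = "norm v"])
    (simp_all add: vector_sadd_rdistrib norm_vector_scalar_mult vec_eq_iff algebra_simps)

lemma holo_on_frechet_derivative:
  assumes "holo_on s F \<Omega>" "z \<in> \<Omega>"
  shows "(F has_derivative frechet_derivative F (at z)) (at z)"
    and "frechet_derivative F (at z) (c *s v) = s c (frechet_derivative F (at z) v)"
    and "frechet_derivative F (at z) (v + w) = frechet_derivative F (at z) v + frechet_derivative F (at z) w"
proof -
  obtain f' where f': "(F has_derivative f') (at z)" "\<And>c v. f' (c *s v) = s c (f' v)"
    using assms unfolding holo_on_def by blast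
  have eq: "frechet_derivative F (at z) = f'" using frechet_derivative_at[OF f'(1)] by simp
  show "(F has_derivative frechet_derivative F (at z)) (at z)"
    "frechet_derivative F (at z) (c *s v) = s c (frechet_derivative F (at z) v)"
    "frechet_derivative F (at z) (v + w) = frechet_derivative F (at z) v + frechet_derivative F (at z) w"
    using f' unfolding eq by (auto simp: linear_add has_derivative_linear)
qed

lemma holo_on_imp_continuous_on:
  "holo_on s F \<Omega> \<Longrightarrow> continuous_on \<Omega> F"
  using holo_on_frechet_derivative(1) has_derivative_continuous continuous_at_imp_continuous_on
  by metis

lemma holo_on_slice_derivative:
  fixes G :: "complex^'n \<Rightarrow> complex"
  assumes "holo_on (*) G \<Omega>" "a + \<zeta> *s v \<in> \<Omega>"
  shows "((\<lambda>\<zeta>. G (a + \<zeta> *s v)) has_field_derivative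
    frechet_derivative G (at (a + \<zeta> *s v)) v) (at \<zeta>)"
proof -
  let ?D = "frechet_derivative G (at (a + \<zeta> *s v))"
  have 1: "((\<lambda>\<zeta>. a + \<zeta> *s v) has_derivative (\<lambda>x. x *s v)) (at \<zeta>)"
    using bounded_linear.has_derivative[OF bounded_linear_vector_scalar_mult_left has_derivative_ident]
    by (auto intro!: derivative_eq_intros)
  have "((\<lambda>\<zeta>. G (a + \<zeta> *s v)) has_derivative (\<lambda>x. ?D (x *s v))) (at \<zeta>)"
    by (rule has_derivative_compose[OF 1 holo_on_frechet_derivative(1)[OF assms]])
  moreover have "(\<lambda>x. ?D (x *s v)) = (*) (?D v)"
    using holo_on_frechet_derivative(2)[OF assms] by (auto simp: mult.commute)
  ultimately show ?thesis by (simp add: has_field_derivative_def)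
qed

lemma holo_on_slice_holomorphic:
  fixes G :: "complex^'n \<Rightarrow> complex"
  assumes "holo_on (*) G \<Omega>" "\<And>\<zeta>. \<zeta> \<in> S \<Longrightarrow> a + \<zeta> *s v \<in> \<Omega>"
  shows "(\<lambda>\<zeta>. G (a + \<zeta> *s v)) holomorphic_on S"
  unfolding holomorphic_on_def
  using holo_on_slice_derivative[OF assms(1) assms(2)] field_differentiable_at_within
    field_differentiable_def by metis

text \<open>Cauchy's estimates make the Taylor remainder of the slices uniform in the direction.\<close>

lemma has_derivative_of_slices:
  fixes H :: "complex^'n \<Rightarrow> complex"
  assumes R: "R > 0" and bd: "\<And>w. norm w < 2 * R \<Longrightarrow> cmod (H (z + w)) \<le> M"
    and hol: "\<And>v. norm v \<le> R \<Longrightarrow> (\<lambda>s. H (z + s *s v)) holomorphic_on ball 0 2"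
    and der: "\<And>v. norm v \<le> R \<Longrightarrow> deriv (\<lambda>s. H (z + s *s v)) 0 = B v"
    and B: "linear B" "\<And>c v. B (c *s v) = c * B v"
  shows "(H has_derivative B) (at z)"
proof -
  have rem: "cmod (H (z + w) - H z - B w) / norm w \<le> 8 * M / R\<^sup>2 * norm w"
    if w: "norm w < R" "w \<noteq> 0" for w
  proof -
    define v where "v = complex_of_real (R / norm w) *s w"
    define s where "s = complex_of_real (norm w / R)"
    have sv: "s *s v = w" using w R by (simp add: v_def s_def vec_eq_iff)
    have nv: "norm v \<le> R" using w R by (simp add: v_def norm_vector_scalar_mult norm_divide)
    have ns: "cmod s \<le> 1" using w R by (simp add: s_def norm_divide)
    have "cmod (H (z + s *s v) - H (z + 0 *s v) - s * deriv (\<lambda>s. H (z + s *s v)) 0) \<le> 8 * M * (cmod s)\<^sup>2"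
    proof (rule holomorphic_Taylor2[OF hol[OF nv] _ ns])
      fix t :: complex assume t: "t \<in> ball 0 2"
      have "cmod t * norm v \<le> cmod t * R" using nv by (intro mult_left_mono) auto
      also have "\<dots> < 2 * R" using t R by simp
      finally show "cmod (H (z + t *s v)) \<le> M"
        by (intro bd) (simp add: norm_vector_scalar_mult)
    qed
    moreover have "s * deriv (\<lambda>s. H (z + s *s v)) 0 = B w"
      using der[OF nv] B(2)[of s v] sv by simp
    ultimately have "cmod (H (z + w) - H z - B w) \<le> 8 * M * (norm w / R)\<^sup>2"
      using sv R by (simp add: s_def norm_divide)
    then show ?thesis using w R by (simp add: field_simps power2_eq_square)
  qed
  show ?thesis unfolding has_derivative_at
  proof
    show "bounded_linear B" using B(1) linear_conv_bounded_linear by blast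
    show "(\<lambda>w. norm (H (z + w) - H z - B w) / norm w) \<midarrow>0\<rightarrow> 0"
    proof (rule Lim_null_comparison)
      show "\<forall>\<^sub>F w in at 0. norm (norm (H (z + w) - H z - B w) / norm w) \<le> 8 * M / R\<^sup>2 * norm w"
        unfolding eventually_at using R rem by (intro exI[of _ R]) (auto simp: dist_norm)
      show "(\<lambda>w. 8 * M / R\<^sup>2 * norm w) \<midarrow>0\<rightarrow> 0"
        by (rule tendsto_eq_intros tendsto_norm_zero tendsto_ident_at refl)+ simp
    qed
  qed
qed

text \<open>
  The difference quotients of \<open>G\<close> in direction \<open>h\<close> converge locally uniformly, so by Weierstrass'
  theorem the slices of the limit are holomorphic and their derivatives are limits of the
  derivatives of the quotients; in particular they are linear in the direction of the slice.
\<close>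

lemma holo_on_directional_small:
  fixes G :: "complex^'n \<Rightarrow> complex"
  assumes G: "holo_on (*) G \<Omega>" and R: "R > 0" "cball z (4 * R) \<subseteq> \<Omega>" and h: "norm h \<le> R"
  shows "\<exists>B. ((\<lambda>y. frechet_derivative G (at y) h) has_derivative B) (at z) \<and> (\<forall>c v. B (c *s v) = c * B v)"
proof -
  define H where "H = (\<lambda>y. frechet_derivative G (at y) h)"
  have "compact (G ` cball z (4 * R))"
    using holo_on_imp_continuous_on[OF G] R(2)
    by (intro compact_continuous_image) (auto intro: continuous_on_subset)
  then obtain M where M: "\<And>y. y \<in> cball z (4 * R) \<Longrightarrow> cmod (G y) \<le> M"
    using compact_imp_bounded bounded_iff by (metis imageI)
  have inball: "z + w + t *s h \<in> cball z (4 * R)" if "norm w \<le> 2 * R" "cmod t \<le> 2" for w t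
  proof -
    have "norm (w + t *s h) \<le> norm w + cmod t * norm h"
      using norm_triangle_ineq[of w "t *s h"] by (simp add: norm_vector_scalar_mult)
    also have "\<dots> \<le> 2 * R + 2 * R"
      using that h R by (intro add_mono mult_mono) auto
    finally have "norm (w + t *s h) \<le> 4 * R" by simp
    moreover have "dist z (z + w + t *s h) = norm (w + t *s h)"
      by (subst dist_commute) (simp add: dist_norm add.assoc)
    ultimately show ?thesis by simp
  qed
  have taylor: "cmod (G (z + w + t *s h) - G (z + w) - t * H (z + w)) \<le> 8 * M * (cmod t)\<^sup>2"
    if w: "norm w \<le> 2 * R" and t: "cmod t \<le> 1" for w t
  proof -
    let ?\<psi> = "\<lambda>t. G (z + w + t *s h)"
    have in\<Omega>: "z + w + t *s h \<in> \<Omega>" if "t \<in> ball 0 2" for t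
      using inball[OF w, of t] that R(2) by auto
    have "cmod (?\<psi> t - ?\<psi> 0 - t * deriv ?\<psi> 0) \<le> 8 * M * (cmod t)\<^sup>2"
    proof (rule holomorphic_Taylor2[OF _ _ t])
      show "?\<psi> holomorphic_on ball 0 2"
        by (rule holo_on_slice_holomorphic[OF G in\<Omega>])
      show "cmod (?\<psi> t) \<le> M" if "t \<in> ball 0 2" for t
        using inball[OF w, of t] that M by auto
    qed
    moreover have "deriv ?\<psi> 0 = H (z + w)"
      using DERIV_imp_deriv[OF holo_on_slice_derivative[OF G in\<Omega>[of 0]]] by (simp add: H_def)
    ultimately show ?thesis by simp
  qed
  have Hbd: "cmod (H (z + w)) \<le> 10 * M" if w: "norm w \<le> 2 * R" for w
  proof -
    have "cmod (G (z + w + 1 *s h) - G (z + w) - 1 * H (z + w)) \<le> 8 * M"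
      using taylor[OF w, of 1] by simp
    moreover have "cmod (G (z + w + 1 *s h)) \<le> M" "cmod (G (z + w)) \<le> M"
      using inball[OF w, of 1] inball[OF w, of 0] M by auto
    moreover have "cmod (H (z + w)) \<le> cmod (G (z + w + 1 *s h) - G (z + w) - 1 * H (z + w))
         + cmod (G (z + w + 1 *s h)) + cmod (G (z + w))"
      using norm_triangle_ineq4[of "G (z + w + 1 *s h) - G (z + w)" "G (z + w + 1 *s h) - G (z + w) - 1 * H (z + w)"]
        norm_triangle_ineq4[of "G (z + w + 1 *s h)" "G (z + w)"] by simp
    ultimately show ?thesis by linarith
  qed
  define \<tau> :: "nat \<Rightarrow> complex" where "\<tau> = (\<lambda>n. inverse (of_nat (Suc n)))"
  have \<tau>1: "cmod (\<tau> n) \<le> 1" for n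
    unfolding \<tau>_def norm_inverse norm_of_nat by (rule inverse_le_1_iff[THEN iffD2]) simp
  have \<tau>0: "\<tau> n \<noteq> 0" for n
    by (simp add: \<tau>_def del: of_nat_Suc)
  define Q where "Q = (\<lambda>n y. (G (y + \<tau> n *s h) - G y) / \<tau> n)"
  have Q: "cmod (Q n (z + w) - H (z + w)) \<le> 8 * M * cmod (\<tau> n)" if w: "norm w \<le> 2 * R" for n w
  proof -
    have "\<tau> n * (Q n (z + w) - H (z + w)) = G (z + w + \<tau> n *s h) - G (z + w) - \<tau> n * H (z + w)"
      unfolding right_diff_distrib Q_def using \<tau>0 by simp
    then have "cmod (\<tau> n * (Q n (z + w) - H (z + w))) \<le> 8 * M * (cmod (\<tau> n))\<^sup>2"
      using taylor[OF w \<tau>1, of n] by simp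
    then have "cmod (\<tau> n) * cmod (Q n (z + w) - H (z + w)) \<le> cmod (\<tau> n) * (8 * M * cmod (\<tau> n))"
      by (simp add: norm_mult power2_eq_square mult_ac)
    then show ?thesis using \<tau>0[of n] by simp
  qed
  have \<tau>lim: "\<tau> \<longlonglongrightarrow> 0"
    unfolding \<tau>_def using LIMSEQ_Suc[OF lim_inverse_n] by simp
  define L where "L = (\<lambda>n w v. (frechet_derivative G (at (z + w + \<tau> n *s h)) v
       - frechet_derivative G (at (z + w)) v) / \<tau> n)"
  have small: "norm (s *s v) \<le> 2 * R" if "norm v \<le> R" "cmod s \<le> 2" for s v
    using mult_mono[of "cmod s" 2 "norm v" R] that R by (simp add: norm_vector_scalar_mult)
  have slice: "(\<lambda>s. H (z + s *s v)) holomorphic_on ball 0 2 \<and>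
     (\<lambda>n. L n 0 v) \<longlonglongrightarrow> deriv (\<lambda>s. H (z + s *s v)) 0" if v: "norm v \<le> R" for v
  proof -
    have in1: "z + \<tau> n *s h + s *s v \<in> \<Omega>" and in2: "z + s *s v \<in> \<Omega>" if "cmod s \<le> 2" for s n
      using inball[OF small[OF v that], of "\<tau> n"] inball[OF small[OF v that], of 0] \<tau>1[of n] R(2)
      by (auto simp: add_ac)
    have der: "((\<lambda>s. Q n (z + s *s v)) has_field_derivative L n (s *s v) v) (at s)"
      if "cmod s \<le> 2" for n s
    proof -
      have "((\<lambda>s. (G (z + \<tau> n *s h + s *s v) - G (z + s *s v)) / \<tau> n) has_field_derivative
        (frechet_derivative G (at (z + \<tau> n *s h + s *s v)) v - frechet_derivative G (at (z + s *s v)) v) / \<tau> n) (at s)"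
        by (intro DERIV_cdivide DERIV_diff holo_on_slice_derivative[OF G] in1 in2 that)
      then show ?thesis by (simp add: Q_def L_def add_ac)
    qed
    have ulim: "uniform_limit (cball 0 2) (\<lambda>n s. Q n (z + s *s v)) (\<lambda>s. H (z + s *s v)) sequentially"
    proof (rule uniform_limitI)
      fix e :: real assume "e > 0"
      have "(\<lambda>n. 8 * M * cmod (\<tau> n)) \<longlonglongrightarrow> 8 * M * 0"
        using \<tau>lim by (intro tendsto_intros) (simp add: tendsto_norm_zero_iff)
      then have "\<forall>\<^sub>F n in sequentially. 8 * M * cmod (\<tau> n) < e"
        using \<open>e > 0\<close> by (intro order_tendstoD(2)) auto
      then show "\<forall>\<^sub>F n in sequentially. \<forall>s\<in>cball 0 2. dist (Q n (z + s *s v)) (H (z + s *s v)) < e"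
      proof eventually_elim
        case (elim n)
        have "cmod (Q n (z + s *s v) - H (z + s *s v)) < e" if "cmod s \<le> 2" for s
          using Q[OF small[OF v that], of n] elim by linarith
        then show ?case by (auto simp: dist_norm)
      qed
    qed
    obtain g' where g': "\<And>w. w \<in> ball 0 2 \<Longrightarrow> ((\<lambda>s. H (z + s *s v)) has_field_derivative (g' w)) (at w)
        \<and> ((\<lambda>n. L n (w *s v) v) \<longlonglongrightarrow> g' w)"
    proof (rule has_complex_derivative_uniform_limit[OF _ ulim])
      show "\<forall>\<^sub>F n in sequentially. continuous_on (cball 0 2) (\<lambda>s. Q n (z + s *s v)) \<and>
         (\<forall>w\<in>ball 0 2. ((\<lambda>s. Q n (z + s *s v)) has_field_derivative L n (w *s v) v) (at w))"
        using der by (intro always_eventually allI conjI)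
          (auto intro!: continuous_at_imp_continuous_on DERIV_isCont)
    qed auto
    have "(\<lambda>s. H (z + s *s v)) holomorphic_on ball 0 2"
      unfolding holomorphic_on_open[OF open_ball] using g' by blast
    moreover have "(\<lambda>n. L n (0 *s v) v) \<longlonglongrightarrow> deriv (\<lambda>s. H (z + s *s v)) 0"
      using g'[of 0] DERIV_imp_deriv[of "\<lambda>s. H (z + s *s v)" "g' 0" 0] by simp
    ultimately show ?thesis by simp
  qed
  define B where "B = (\<lambda>v. lim (\<lambda>n. L n 0 v))"
  have in0: "z + 0 + \<tau> n *s h \<in> \<Omega>" "z + 0 \<in> \<Omega>" for n
    using inball[of 0 "\<tau> n"] inball[of 0 0] \<tau>1[of n] R by auto
  have Ls: "L n 0 (c *s v) = c * L n 0 v" for n c v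
    unfolding L_def holo_on_frechet_derivative(2)[OF G in0(1)] holo_on_frechet_derivative(2)[OF G in0(2)]
    by (simp add: field_simps)
  have La: "L n 0 (v + w) = L n 0 v + L n 0 w" for n v w
    unfolding L_def holo_on_frechet_derivative(3)[OF G in0(1)] holo_on_frechet_derivative(3)[OF G in0(2)]
    by (simp add: diff_divide_distrib add_divide_distrib)
  have lim: "(\<lambda>n. L n 0 v) \<longlonglongrightarrow> B v" for v
  proof -
    define c where "c = complex_of_real (R / (norm v + R))"
    have nR: "norm v + R > 0" using R by (simp add: add_nonneg_pos)
    have c: "c \<noteq> 0"
      unfolding c_def of_real_eq_0_iff using R nR by simp
    have cR: "norm (c *s v) \<le> R"
      using R nR unfolding c_def norm_vector_scalar_mult norm_of_real
      by (simp add: divide_le_eq mult_left_mono)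
    have "(\<lambda>n. L n 0 (c *s v) / c) \<longlonglongrightarrow> deriv (\<lambda>s. H (z + s *s (c *s v))) 0 / c"
      using slice[OF cR] c by (intro tendsto_intros) auto
    then have "convergent (\<lambda>n. L n 0 v)"
      using c by (auto simp: Ls convergent_def)
    then show ?thesis unfolding B_def using convergent_LIMSEQ_iff by blast
  qed
  have Badd: "B (v + w) = B v + B w" for v w
    using LIMSEQ_unique[OF lim[of "v + w"]] tendsto_add[OF lim[of v] lim[of w]] by (simp add: La)
  have Bscale: "B (c *s v) = c * B v" for c v
    using LIMSEQ_unique[OF lim[of "c *s v"]] tendsto_mult_left[OF lim[of v], of c] by (simp add: Ls)
  have "(H has_derivative B) (at z)"
  proof (rule has_derivative_of_slices[OF R(1)])
    show "cmod (H (z + w)) \<le> 10 * M" if "norm w < 2 * R" for w using Hbd that by simp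
    show "(\<lambda>s. H (z + s *s v)) holomorphic_on ball 0 2" if "norm v \<le> R" for v
      using slice that by blast
    show "deriv (\<lambda>s. H (z + s *s v)) 0 = B v" if "norm v \<le> R" for v
      using LIMSEQ_unique slice that lim by blast
    show "linear B"
    proof (rule linearI)
      show "B (r *\<^sub>R v) = r *\<^sub>R B v" for r v
      proof -
        have "r *\<^sub>R v = complex_of_real r *s v" by (simp add: vec_eq_iff scaleR_conv_of_real[where 'a = complex])
        then show ?thesis using Bscale by (simp add: scaleR_conv_of_real)
      qed
    qed (rule Badd)
  qed (rule Bscale)
  then show ?thesis using Bscale unfolding H_def by blast
qed

lemma holo_on_directional:
  fixes G :: "complex^'n \<Rightarrow> complex"
  assumes \<Omega>: "open \<Omega>" and G: "holo_on (*) G \<Omega>"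
  shows "holo_on (*) (\<lambda>y. frechet_derivative G (at y) h) \<Omega>"
  unfolding holo_on_def
proof
  fix z assume z: "z \<in> \<Omega>"
  obtain e where e: "e > 0" "cball z e \<subseteq> \<Omega>" using \<Omega> z open_contains_cball by blast
  define R where "R = e / 4"
  have R: "R > 0" "cball z (4 * R) \<subseteq> \<Omega>" using e by (auto simp: R_def)
  define c where "c = complex_of_real (R / (norm h + R))"
  have nR: "norm h + R > 0" using R by (simp add: add_nonneg_pos)
  have c: "c \<noteq> 0"
    unfolding c_def of_real_eq_0_iff using R nR by simp
  have cR: "norm (c *s h) \<le> R"
    using R nR unfolding c_def norm_vector_scalar_mult norm_of_real
    by (simp add: divide_le_eq mult_left_mono)
  obtain B where B: "((\<lambda>y. frechet_derivative G (at y) (c *s h)) has_derivative B) (at z)"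
      "\<And>c v. B (c *s v) = c * B v"
    using holo_on_directional_small[OF G R cR] by blast
  have "((\<lambda>y. frechet_derivative G (at y) (c *s h) / c) has_derivative (\<lambda>v. B v / c)) (at z)"
    using B(1) bounded_linear.has_derivative[OF bounded_linear_divide] by blast
  then have "((\<lambda>y. frechet_derivative G (at y) h) has_derivative (\<lambda>v. B v / c)) (at z)"
    by (rule has_derivative_transform_within_open[OF _ \<Omega> z])
      (use c holo_on_frechet_derivative(2)[OF G] in simp)
  then show "\<exists>f'. ((\<lambda>y. frechet_derivative G (at y) h) has_derivative f') (at z) \<and>
      (\<forall>c v. f' (c *s v) = c * f' v)"
    using B(2) by (intro exI[of _ "\<lambda>v. B v / c"]) simp
qed

lemma holo_on_higher_deriv:
  fixes G :: "complex^'n \<Rightarrow> complex"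
  assumes "open \<Omega>" "holo_on (*) G \<Omega>"
  shows "holo_on (*) (higher_deriv G hs) \<Omega>"
proof (induction hs)
  case Nil
  then show ?case using assms(2) by (simp add: holo_on_def)
next
  case (Cons h hs)
  have "higher_deriv G (h # hs) = (\<lambda>y. frechet_derivative (higher_deriv G hs) (at y) h)"
    by (rule ext) simp
  then show ?case using holo_on_directional[OF assms(1) Cons] by simp
qed

lemma higher_deriv_nth:
  fixes F :: "complex^'n \<Rightarrow> complex^'m"
  assumes \<Omega>: "open \<Omega>" and F: "\<And>i. holo_on (*) (\<lambda>z. F z $ i) \<Omega>" and "z \<in> \<Omega>"
  shows "higher_deriv F hs z $ i = higher_deriv (\<lambda>z. F z $ i) hs z"
  using \<open>z \<in> \<Omega>\<close>
proof (induction hs arbitrary: z i)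
  case (Cons h hs)
  let ?D = "\<lambda>i. frechet_derivative (higher_deriv (\<lambda>z. F z $ i) hs) (at z)"
  have "((\<lambda>y. \<Sum>i\<in>UNIV. higher_deriv (\<lambda>z. F z $ i) hs y *s (axis i 1 :: complex^'m)) has_derivative
      (\<lambda>v. \<Sum>i\<in>UNIV. ?D i v *s axis i 1)) (at z)"
    by (intro has_derivative_sum bounded_linear.has_derivative[OF bounded_linear_vector_scalar_mult_left]
        holo_on_frechet_derivative(1)[OF holo_on_higher_deriv[OF \<Omega> F] Cons.prems])
  then have "(higher_deriv F hs has_derivative (\<lambda>v. \<Sum>i\<in>UNIV. ?D i v *s axis i 1)) (at z)"
  proof (rule has_derivative_transform_within_open[OF _ \<Omega> Cons.prems])
    fix y assume "y \<in> \<Omega>"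
    then show "(\<Sum>i\<in>UNIV. higher_deriv (\<lambda>z. F z $ i) hs y *s (axis i 1 :: complex^'m)) = higher_deriv F hs y"
      using Cons.IH[of y] basis_expansion[of "higher_deriv F hs y"] by simp
  qed
  from frechet_derivative_at[OF this, symmetric] show ?case
    by (simp add: axis_def if_distrib cong: if_cong)
qed simp

lemma higher_deriv_slice:
  fixes G :: "complex^'n \<Rightarrow> complex"
  assumes \<Omega>: "open \<Omega>" and G: "holo_on (*) G \<Omega>" and "\<zeta> *s z \<in> \<Omega>"
  shows "(deriv ^^ m) (\<lambda>\<zeta>. G (\<zeta> *s z)) \<zeta> = higher_deriv G (replicate m z) (\<zeta> *s z)"
  using \<open>\<zeta> *s z \<in> \<Omega>\<close>
proof (induction m arbitrary: \<zeta>)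
  case (Suc m)
  let ?S = "(\<lambda>\<zeta>. \<zeta> *s z) -` \<Omega>"
  have S: "open ?S"
    using \<Omega> linear_continuous_at[OF bounded_linear_vector_scalar_mult_left]
    by (intro continuous_open_vimage) auto
  have "((\<lambda>\<zeta>. higher_deriv G (replicate m z) (\<zeta> *s z)) has_field_derivative
     frechet_derivative (higher_deriv G (replicate m z)) (at (\<zeta> *s z)) z) (at \<zeta>)"
    using holo_on_slice_derivative[OF holo_on_higher_deriv[OF \<Omega> G], of 0] Suc.prems by simp
  then have "((deriv ^^ m) (\<lambda>\<zeta>. G (\<zeta> *s z)) has_field_derivative
     frechet_derivative (higher_deriv G (replicate m z)) (at (\<zeta> *s z)) z) (at \<zeta>)"
    by (rule has_field_derivative_transform_within_open[OF _ S]) (use Suc in auto)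
  then show ?case by (simp add: DERIV_imp_deriv)
qed simp

definition vanishes_to_order :: "nat \<Rightarrow> (complex^'n \<Rightarrow> complex) \<Rightarrow> bool" where
  "vanishes_to_order m G \<longleftrightarrow> (\<exists>C r. r > 0 \<and> (\<forall>y. 0 < norm y \<and> norm y < r \<longrightarrow> cmod (G y) \<le> C * norm y ^ m))"

lemma vanishes_to_order_directional:
  fixes G :: "complex^'n \<Rightarrow> complex"
  assumes \<Omega>: "open \<Omega>" "0 \<in> \<Omega>" and G: "holo_on (*) G \<Omega>" and van: "vanishes_to_order (Suc m) G"
  shows "vanishes_to_order m (\<lambda>y. frechet_derivative G (at y) h)"
proof (cases "h = 0")
  case True
  obtain e where e: "e > 0" "ball 0 e \<subseteq> \<Omega>" using \<Omega> open_contains_ball by blast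
  have "frechet_derivative G (at y) 0 = 0" if "y \<in> \<Omega>" for y
    using holo_on_frechet_derivative(2)[OF G that, of 0 0] by simp
  with True e show ?thesis
    unfolding vanishes_to_order_def by (intro exI[of _ 0] exI[of _ e]) (auto simp: subset_iff)
next
  case False
  obtain C r where r: "r > 0" "\<And>y. 0 < norm y \<Longrightarrow> norm y < r \<Longrightarrow> cmod (G y) \<le> C * norm y ^ Suc m"
    using van unfolding vanishes_to_order_def by blast
  obtain e where e: "e > 0" "ball 0 e \<subseteq> \<Omega>" using \<Omega> open_contains_ball by blast
  have "cmod (frechet_derivative G (at y) h) \<le> (max C 0 * 2 ^ Suc m * 2 * norm h) * norm y ^ m"
    if y: "0 < norm y" "norm y < min r e / 2" for y
  proof -
    define \<epsilon> where "\<epsilon> = norm y / (2 * norm h)"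
    have \<epsilon>: "\<epsilon> > 0" using y False by (simp add: \<epsilon>_def)
    have nt: "norm (y + t *s h) \<le> 2 * norm y" "0 < norm (y + t *s h)" if "cmod t \<le> \<epsilon>" for t
    proof -
      have "norm (t *s h) \<le> norm y / 2"
        using that False by (simp add: norm_vector_scalar_mult \<epsilon>_def field_simps)
      then show "norm (y + t *s h) \<le> 2 * norm y" "0 < norm (y + t *s h)"
        using norm_triangle_ineq[of y "t *s h"] norm_diff_ineq[of y "t *s h"] y by linarith+
    qed
    have in\<Omega>: "y + t *s h \<in> \<Omega>" if "t \<in> cball 0 \<epsilon>" for t
      using nt[of t] that y e(2) by (auto simp: subset_iff)
    let ?\<psi> = "\<lambda>t. G (y + t *s h)"
    have hol: "?\<psi> holomorphic_on cball 0 \<epsilon>"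
      by (rule holo_on_slice_holomorphic[OF G in\<Omega>])
    have "cmod ((deriv ^^ 1) ?\<psi> 0) \<le> fact 1 * (max C 0 * (2 * norm y) ^ Suc m) / \<epsilon> ^ 1"
    proof (rule Cauchy_inequality)
      show "?\<psi> holomorphic_on ball 0 \<epsilon>" using hol holomorphic_on_subset ball_subset_cball by blast
      show "continuous_on (cball 0 \<epsilon>) ?\<psi>" using hol by (rule holomorphic_on_imp_continuous_on)
      fix t :: complex assume "cmod (0 - t) = \<epsilon>"
      then have t: "cmod t \<le> \<epsilon>" by simp
      have "cmod (?\<psi> t) \<le> C * norm (y + t *s h) ^ Suc m"
        using nt[OF t] y by (intro r(2)) auto
      also have "\<dots> \<le> max C 0 * (2 * norm y) ^ Suc m"
        using nt[OF t] by (intro mult_mono power_mono) auto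
      finally show "cmod (?\<psi> t) \<le> max C 0 * (2 * norm y) ^ Suc m" .
    qed (rule \<epsilon>)
    moreover have "deriv ?\<psi> 0 = frechet_derivative G (at y) h"
      using DERIV_imp_deriv[OF holo_on_slice_derivative[OF G in\<Omega>[of 0]]] \<epsilon> by simp
    moreover have "(max C 0 * (2 * norm y) ^ Suc m) / \<epsilon> = (max C 0 * 2 ^ Suc m * 2 * norm h) * norm y ^ m"
      using y False by (simp add: \<epsilon>_def field_simps power_mult_distrib)
    ultimately show ?thesis by simp
  qed
  moreover have "min r e / 2 > 0" using r e by simp
  ultimately show ?thesis unfolding vanishes_to_order_def by blast
qed

lemma vanishes_to_order_higher_deriv:
  fixes G :: "complex^'n \<Rightarrow> complex"
  assumes \<Omega>: "open \<Omega>" "0 \<in> \<Omega>" and G: "holo_on (*) G \<Omega>"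
  shows "vanishes_to_order (m + length hs) G \<Longrightarrow> vanishes_to_order m (higher_deriv G hs)"
proof (induction hs arbitrary: m)
  case (Cons h hs)
  then have "vanishes_to_order (Suc m) (higher_deriv G hs)" by simp
  from vanishes_to_order_directional[OF \<Omega> holo_on_higher_deriv[OF \<Omega>(1) G] this]
  show ?case by (simp add: vanishes_to_order_def)
qed (simp add: vanishes_to_order_def)

lemma higher_deriv_0_eq_0:
  fixes G :: "complex^'n \<Rightarrow> complex"
  assumes \<Omega>: "open \<Omega>" "0 \<in> \<Omega>" and G: "holo_on (*) G \<Omega>"
    and van: "vanishes_to_order m G" and len: "length hs < m"
  shows "higher_deriv G hs 0 = 0"
proof -
  obtain l where l: "m = Suc l + length hs" using len less_iff_Suc_add by (metis add_Suc add.commute)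
  obtain C r where r: "r > 0"
    "\<And>y. 0 < norm y \<Longrightarrow> norm y < r \<Longrightarrow> cmod (higher_deriv G hs y) \<le> C * norm y ^ Suc l"
    using vanishes_to_order_higher_deriv[OF \<Omega> G] van l unfolding vanishes_to_order_def by metis
  have "(\<lambda>y. C * norm y ^ Suc l) \<midarrow>(0::complex^'n)\<rightarrow> 0"
    by (auto intro!: tendsto_eq_intros)
  then have "higher_deriv G hs \<midarrow>0\<rightarrow> 0"
    by (rule Lim_null_comparison[rotated])
      (use r in \<open>auto simp: eventually_at intro!: exI[of _ r]\<close>)
  moreover have "isCont (higher_deriv G hs) 0"
    using holo_on_imp_continuous_on[OF holo_on_higher_deriv[OF \<Omega>(1) G]] \<Omega>
      continuous_on_eq_continuous_at by blast
  ultimately show ?thesis using LIM_unique isCont_def by blast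
qed

section \<open>Lower-dimensional manifolds\<close>

lemma manifold_chart_meagre:
  fixes U S V :: "'a::euclidean_space set"
  assumes S: "subspace S" "dim S < DIM('a)" and V: "openin (top_of_set S) V"
    and UV: "U homeomorphic V"
  shows "\<exists>\<K>. countable \<K> \<and> U = \<Union>\<K> \<and> (\<forall>K\<in>\<K>. closed K \<and> interior K = {})"
proof -
  obtain f g where fg: "homeomorphism U V f g"
    using UV unfolding homeomorphic_def by blast
  obtain T where T: "open T" "V = S \<inter> T"
    using V by (auto simp: openin_open)
  obtain C :: "nat \<Rightarrow> 'a set" where C: "\<And>n. compact (C n)" "\<Union>(range C) = T"
    using open_Union_compact_subsets[OF T(1)] by metis
  have "closed (g ` (S \<inter> C n)) \<and> interior (g ` (S \<inter> C n)) = {}" for n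
  proof
    have sub: "S \<inter> C n \<subseteq> V" using C T by blast
    have "compact (S \<inter> C n)"
      using C(1) closed_Int_compact closed_subspace S(1) by blast
    then show "closed (g ` (S \<inter> C n))"
      using fg sub by (meson compact_continuous_image compact_imp_closed continuous_on_subset
          homeomorphism_def)
    define B where "B = interior (g ` (S \<inter> C n))"
    have BU: "B \<subseteq> U"
      using interior_subset[of "g ` (S \<inter> C n)"] homeomorphism_image2[OF fg] sub unfolding B_def by blast
    show "B = {}"
    proof (rule ccontr)
      assume "B \<noteq> {}"
      have "dim (UNIV :: 'a set) \<le> dim S"
      proof (rule invariance_of_dimension_subspaces[of UNIV B S f])
        show "continuous_on B f"
          using fg BU by (meson continuous_on_subset homeomorphism_def)
        show "f \<in> B \<rightarrow> S"
          using homeomorphism_image1[OF fg] BU T(2) by blast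
        show "inj_on f B"
          using fg BU by (metis homeomorphism_apply1 inj_onI subsetD)
      qed (use S \<open>B \<noteq> {}\<close> in \<open>auto simp: B_def\<close>)
      then show False using S by simp
    qed
  qed
  moreover have "U = \<Union>(range (\<lambda>n. g ` (S \<inter> C n)))"
  proof -
    have "U = g ` V" using fg by (simp add: homeomorphism_def)
    also have "V = (\<Union>n. S \<inter> C n)" using C T by blast
    finally show ?thesis by blast
  qed
  ultimately show ?thesis
    by (intro exI[of _ "range (\<lambda>n. g ` (S \<inter> C n))"]) auto
qed

lemma manifold_meagre:
  fixes M :: "'a::euclidean_space set"
  assumes M: "manifold_of_dim d M" and d: "d < DIM('a)"
  shows "\<exists>\<K>. countable \<K> \<and> M = \<Union>\<K> \<and> (\<forall>K\<in>\<K>. closed K \<and> interior K = {})"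
proof -
  define \<F> where "\<F> = {U. openin (top_of_set M) U \<and>
    (\<exists>S V. subspace S \<and> dim S = d \<and> openin (top_of_set S) (V::'a set) \<and> U homeomorphic V)}"
  obtain \<F>' where F': "\<F>' \<subseteq> \<F>" "countable \<F>'" "\<Union>\<F>' = \<Union>\<F>"
    using Lindelof_openin[of \<F> M] unfolding \<F>_def by blast
  have "\<Union>\<F> = M"
  proof
    show "\<Union>\<F> \<subseteq> M" unfolding \<F>_def using openin_imp_subset by blast
    show "M \<subseteq> \<Union>\<F>"
    proof
      fix p assume "p \<in> M"
      then obtain U S V where "p \<in> U" "openin (top_of_set M) U" "subspace S" "dim S = d"
        "openin (top_of_set S) (V::'a set)" "U homeomorphic V"
        using M unfolding manifold_of_dim_def by meson
      then show "p \<in> \<Union>\<F>" unfolding \<F>_def by auto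
    qed
  qed
  have "\<forall>U\<in>\<F>'. \<exists>\<K>. countable \<K> \<and> U = \<Union>\<K> \<and> (\<forall>K\<in>\<K>. closed K \<and> interior K = {})"
    proof
    fix U assume "U \<in> \<F>'"
    then obtain S V where "subspace S" "dim S = d" "openin (top_of_set S) (V::'a set)"
      "U homeomorphic V"
      using F'(1) unfolding \<F>_def by auto
    then show "\<exists>\<K>. countable \<K> \<and> U = \<Union>\<K> \<and> (\<forall>K\<in>\<K>. closed K \<and> interior K = {})"
      using d manifold_chart_meagre by metis
  qed
  then obtain \<K> where K: "\<And>U. U \<in> \<F>' \<Longrightarrow>
      countable (\<K> U) \<and> \<Union>(\<K> U) = U \<and> (\<forall>K\<in>\<K> U. closed K \<and> interior K = {})"
    by metis
  have "M = \<Union>(\<Union>U\<in>\<F>'. \<K> U)"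
  proof -
    have "\<Union>(\<Union>U\<in>\<F>'. \<K> U) = (\<Union>U\<in>\<F>'. \<Union>(\<K> U))" by blast
    also have "\<dots> = \<Union>\<F>'" using K by simp
    finally show ?thesis using F'(3) \<open>\<Union>\<F> = M\<close> by simp
  qed
  moreover have "countable (\<Union>U\<in>\<F>'. \<K> U)" "\<forall>K\<in>(\<Union>U\<in>\<F>'. \<K> U). closed K \<and> interior K = {}"
    using K F'(2) by auto
  ultimately show ?thesis by blast
qed

lemma closure_Compl_lower_dim_manifolds:
  fixes E :: "(complex^'n) set"
  assumes "lower_dim_manifolds E"
  shows "closure (- E) = UNIV"
proof -
  obtain \<M> where M: "countable \<M>" "E = \<Union>\<M>" 
    "\<And>M. M \<in> \<M> \<Longrightarrow> \<exists>d < 2 * CARD('n). manifold_of_dim d M"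
    using assms unfolding lower_dim_manifolds_def by blast
  have "\<forall>M\<in>\<M>. \<exists>\<K>. countable \<K> \<and> M = \<Union>\<K> \<and> (\<forall>K\<in>\<K>. closed K \<and> interior K = {})"
    using M(3) manifold_meagre[where 'a = "complex^'n"] by (auto simp: mult.commute)
  then obtain \<K> where K: "\<And>M. M \<in> \<M> \<Longrightarrow>
      countable (\<K> M) \<and> \<Union>(\<K> M) = M \<and> (\<forall>K\<in>\<K> M. closed K \<and> interior K = {})"
    by metis
  define \<G> where "\<G> = uminus ` (\<Union>M\<in>\<M>. \<K> M)"
  have "UNIV \<subseteq> closure (\<Inter>\<G>)"
  proof (rule Baire)
    show "countable \<G>" using K M(1) by (auto simp: \<G>_def)
    show "openin (top_of_set UNIV) T \<and> UNIV \<subseteq> closure T" if "T \<in> \<G>" for T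
      using that K by (auto simp: \<G>_def closure_complement open_Compl)
  qed auto
  moreover have "\<Inter>\<G> = - E"
  proof -
    have "\<Inter>\<G> = - (\<Union>M\<in>\<M>. \<Union>(\<K> M))" unfolding \<G>_def by auto
    also have "(\<Union>M\<in>\<M>. \<Union>(\<K> M)) = E" using K M(2) by simp
    finally show ?thesis .
  qed
  ultimately show ?thesis by auto
qed

section \<open>Starlike circular domains\<close>

lemma bounded_bilinear_vector_scalar_mult: "bounded_bilinear (\<lambda>c (v :: complex^'n). c *s v)"
proof
  show "\<exists>K. \<forall>c (v :: complex^'n). norm (c *s v) \<le> norm c * norm v * K"
    by (intro exI[of _ 1]) (simp add: norm_vector_scalar_mult)
qed (simp_all add: vec_eq_iff algebra_simps)

lemma scalar_product_scale: "scalar_product w (c *s v) = c * scalar_product w v" for c :: complex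
  by (simp add: scalar_product_def sum_distrib_left mult_ac)

lemma linear_complex_vec_expansion:
  fixes D :: "complex^'n \<Rightarrow> real"
  assumes "linear D"
  shows "D w = (\<Sum>j\<in>UNIV. Re (w $ j) * D (axis j 1) + Im (w $ j) * D (axis j \<i>))"
proof -
  have "w = (\<Sum>j\<in>UNIV. Re (w $ j) *\<^sub>R axis j 1 + Im (w $ j) *\<^sub>R axis j \<i>)"
    by (simp add: vec_eq_iff axis_def if_distrib complex_eq_iff sum.distrib cong: if_cong)
  then have "D w = D (\<Sum>j\<in>UNIV. Re (w $ j) *\<^sub>R axis j 1 + Im (w $ j) *\<^sub>R axis j \<i>)" by simp
  also have "\<dots> = (\<Sum>j\<in>UNIV. Re (w $ j) * D (axis j 1) + Im (w $ j) * D (axis j \<i>))"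
    using assms by (simp add: linear_sum linear_add linear_scale)
  finally show ?thesis .
qed

lemma scalar_product_wirtinger:
  assumes "\<rho> differentiable (at z)"
  shows "scalar_product (wirtinger \<rho> z) w =
    (complex_of_real (frechet_derivative \<rho> (at z) w)
     - \<i> * complex_of_real (frechet_derivative \<rho> (at z) (\<i> *s w))) / 2"
proof -
  let ?D = "frechet_derivative \<rho> (at z)"
  have lin: "linear ?D" using assms linear_frechet_derivative by blast
  show ?thesis
    unfolding linear_complex_vec_expansion[OF lin, of w] linear_complex_vec_expansion[OF lin, of "\<i> *s w"]
    by (simp add: scalar_product_def wirtinger_def complex_eq_iff sum_divide_distrib[symmetric]
        sum_subtractf[symmetric] sum.distrib[symmetric] sum_negf[symmetric] algebra_simps cong: sum.cong)
qed

lemma starlike_circular_domain_iff: "starlike_circular_domain \<Omega> \<rho> \<Longrightarrow> z \<in> \<Omega> \<longleftrightarrow> \<rho> z < 1"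
  unfolding starlike_circular_domain_def by blast

lemma starlike_circular_domain_scale:
  "starlike_circular_domain \<Omega> \<rho> \<Longrightarrow> \<rho> (t *s z) = cmod t * \<rho> z"
  unfolding starlike_circular_domain_def by blast

lemma starlike_circular_domain_pos: "starlike_circular_domain \<Omega> \<rho> \<Longrightarrow> z \<noteq> 0 \<Longrightarrow> \<rho> z > 0"
  unfolding starlike_circular_domain_def by (metis less_eq_real_def)

lemma minkowski_derivative_curve:
  assumes dom: "starlike_circular_domain \<Omega> \<rho>" and diff: "\<rho> differentiable (at z)"
    and c: "(c has_vector_derivative c') (at (0::real))" "c 0 = 1"
    and n: "((\<lambda>t. cmod (c t)) has_real_derivative n') (at 0)"
  shows "frechet_derivative \<rho> (at z) (c' *s z) = n' * \<rho> z"
proof -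
  let ?D = "frechet_derivative \<rho> (at z)"
  have lin: "linear ?D" using diff linear_frechet_derivative by blast
  have D: "(\<rho> has_derivative ?D) (at (c 0 *s z))" using frechet_derivative_works[THEN iffD1, OF diff] c(2) by simp
  have "((\<lambda>t. c t *s z) has_derivative (\<lambda>t. (t *\<^sub>R c') *s z)) (at 0)"
    using bounded_linear.has_derivative[OF bounded_linear_vector_scalar_mult_left]
      c(1)[unfolded has_vector_derivative_def] by blast
  from has_derivative_compose[OF this D]
  have "((\<lambda>t. \<rho> (c t *s z)) has_derivative (\<lambda>t. ?D ((t *\<^sub>R c') *s z))) (at 0)" .
  moreover have "?D ((t *\<^sub>R c') *s z) = ?D (c' *s z) * t" for t
  proof -
    have "(t *\<^sub>R c') *s z = t *\<^sub>R (c' *s z)" by (simp add: vec_eq_iff)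
    then show ?thesis using lin by (simp add: linear_scale)
  qed
  ultimately have "((\<lambda>t. \<rho> (c t *s z)) has_real_derivative ?D (c' *s z)) (at 0)"
    by (simp add: has_field_derivative_def)
  moreover have "((\<lambda>t. \<rho> (c t *s z)) has_real_derivative n' * \<rho> z) (at 0)"
    unfolding starlike_circular_domain_scale[OF dom] by (rule DERIV_cmult_right[OF n])
  ultimately show ?thesis using DERIV_unique by blast
qed

lemma scalar_product_wirtinger_self:
  assumes dom: "starlike_circular_domain \<Omega> \<rho>" and diff: "\<rho> differentiable (at z)"
  shows "scalar_product (wirtinger \<rho> z) z = of_real (\<rho> z) / 2"
proof -
  have "frechet_derivative \<rho> (at z) (1 *s z) = 1 * \<rho> z"
  proof (rule minkowski_derivative_curve[OF dom diff, of "\<lambda>t. of_real (1 + t)"])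
    show "((\<lambda>t. complex_of_real (1 + t)) has_vector_derivative 1) (at 0)"
      by (auto intro!: derivative_eq_intros simp: has_vector_derivative_def scaleR_conv_of_real)
    have "((\<lambda>t::real. 1 + t) has_real_derivative 1) (at 0)"
      by (auto intro!: derivative_eq_intros)
    then show "((\<lambda>t. cmod (complex_of_real (1 + t))) has_real_derivative 1) (at 0)"
      by (rule has_field_derivative_transform_within_open[of _ _ _ "{-1<..}"]) (auto simp del: of_real_add)
  qed simp
  moreover have "frechet_derivative \<rho> (at z) (\<i> *s z) = 0 * \<rho> z"
  proof (rule minkowski_derivative_curve[OF dom diff, of cis])
    show "(cis has_vector_derivative \<i>) (at 0)"
      by (auto intro!: derivative_eq_intros simp: has_vector_derivative_def scaleR_conv_of_real)
    show "((\<lambda>t. cmod (cis t)) has_real_derivative 0) (at 0)" by simp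
  qed simp
  ultimately show ?thesis by (simp add: scalar_product_wirtinger[OF diff])
qed

lemma minkowski_not_differentiable_0:
  assumes dom: "starlike_circular_domain \<Omega> \<rho>"
  shows "\<not> \<rho> differentiable (at (0 :: complex^'n))"
proof
  assume "\<rho> differentiable (at 0)"
  then obtain D where D: "(\<rho> has_derivative D) (at 0)" unfolding differentiable_def by blast
  have \<rho>0: "\<rho> 0 = 0" using dom unfolding starlike_circular_domain_def by blast
  have "D = (\<lambda>h. 0)"
  proof (rule differential_zero_maxmin[of 0 UNIV])
    show "(\<forall>y\<in>UNIV. \<rho> y \<le> \<rho> 0) \<or> (\<forall>y\<in>UNIV. \<rho> 0 \<le> \<rho> y)"
      using dom unfolding \<rho>0 starlike_circular_domain_def by blast
  qed (use D in auto)
  then have lim: "(\<lambda>h. \<rho> h / norm h) \<midarrow>0\<rightarrow> 0"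
    using D dom \<rho>0 unfolding has_derivative_at starlike_circular_domain_def by simp
  define v :: "complex^'n" where "v = axis undefined 1"
  have v: "v \<noteq> 0" by (simp add: v_def axis_eq_0_iff)
  have "(\<lambda>t. complex_of_real t *s v) \<midarrow>0\<rightarrow> of_real 0 *s v"
    by (intro bounded_linear.tendsto[OF bounded_linear_vector_scalar_mult_left] tendsto_intros)
  then have "filterlim (\<lambda>t. complex_of_real t *s v) (at 0) (at 0)"
    using v by (auto simp: filterlim_at eventually_at_filter)
  from filterlim_compose[OF lim this]
  have "((\<lambda>t. \<rho> (of_real t *s v) / norm (complex_of_real t *s v)) \<longlongrightarrow> 0) (at 0)" .
  moreover have "\<forall>\<^sub>F t in at 0. \<rho> (of_real t *s v) / norm (complex_of_real t *s v) = \<rho> v / norm v"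
    unfolding starlike_circular_domain_scale[OF dom] norm_vector_scalar_mult
    by (auto simp: eventually_at_filter)
  ultimately have "((\<lambda>t::real. \<rho> v / norm v) \<longlongrightarrow> 0) (at 0)" by (rule Lim_transform_eventually)
  then have "\<rho> v / norm v = 0" using tendsto_const_iff trivial_limit_at by blast
  then show False using v starlike_circular_domain_pos[OF dom v] by simp
qed

lemma holo_on_mult:
  assumes "holo_on (*) f \<Omega>" "holo_on (*) g \<Omega>"
  shows "holo_on (*) (\<lambda>z. f z * g z :: complex) \<Omega>"
  unfolding holo_on_def
proof
  fix z assume z: "z \<in> \<Omega>"
  show "\<exists>f'. ((\<lambda>z. f z * g z) has_derivative f') (at z) \<and> (\<forall>c v. f' (c *s v) = c * f' v)"
    using has_derivative_mult[OF holo_on_frechet_derivative(1)[OF assms(1) z] holo_on_frechet_derivative(1)[OF assms(2) z]]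
      holo_on_frechet_derivative(2)[OF assms(1) z] holo_on_frechet_derivative(2)[OF assms(2) z]
    by (intro exI conjI) (assumption, simp add: algebra_simps)
qed

lemma holo_on_diff_const:
  assumes "holo_on (*) f \<Omega>"
  shows "holo_on (*) (\<lambda>z. f z - c :: complex) \<Omega>"
  unfolding holo_on_def
proof
  fix z assume z: "z \<in> \<Omega>"
  show "\<exists>f'. ((\<lambda>z. f z - c) has_derivative f') (at z) \<and> (\<forall>c v. f' (c *s v) = c * f' v)"
    using has_derivative_diff[OF holo_on_frechet_derivative(1)[OF assms(1) z] has_derivative_const]
      holo_on_frechet_derivative(2)[OF assms(1) z]
    by (intro exI conjI) (assumption, simp)
qed

lemma holo_on_nth: "holo_on (*) (\<lambda>z. z $ i) \<Omega>"
  unfolding holo_on_def using bounded_linear.has_derivative[OF bounded_linear_vec_nth has_derivative_ident]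
  by fastforce

lemma has_derivative_scalar_times_id:
  fixes f :: "complex^'n \<Rightarrow> complex"
  assumes "holo_on (*) f \<Omega>" "z \<in> \<Omega>"
  shows "((\<lambda>z. f z *s z) has_derivative (\<lambda>v. f z *s v + frechet_derivative f (at z) v *s z)) (at z)"
  by (rule bounded_bilinear.FDERIV[OF bounded_bilinear_vector_scalar_mult
     holo_on_frechet_derivative(1)[OF assms] has_derivative_ident])

lemma frechet_derivative_scalar_times_id:
  fixes f :: "complex^'n \<Rightarrow> complex"
  assumes "holo_on (*) f \<Omega>" "z \<in> \<Omega>"
  shows "frechet_derivative (\<lambda>z. f z *s z) (at z) = (\<lambda>v. f z *s v + frechet_derivative f (at z) v *s z)"
  using frechet_derivative_at[OF has_derivative_scalar_times_id[OF assms]] by simp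

lemma slice_holomorphic_near_0:
  fixes f :: "complex^'n \<Rightarrow> complex"
  assumes \<Omega>: "open \<Omega>" "0 \<in> \<Omega>" and f: "holo_on (*) f \<Omega>"
  obtains S where "open S" "0 \<in> S" "\<And>\<zeta>. \<zeta> \<in> S \<Longrightarrow> \<zeta> *s z \<in> \<Omega>" "(\<lambda>\<zeta>. f (\<zeta> *s z)) holomorphic_on S"
proof
  let ?S = "(\<lambda>\<zeta>. \<zeta> *s z) -` \<Omega>"
  show "open ?S"
    using \<Omega> linear_continuous_at[OF bounded_linear_vector_scalar_mult_left]
    by (intro continuous_open_vimage) auto
  show "(\<lambda>\<zeta>. f (\<zeta> *s z)) holomorphic_on ?S"
    using holo_on_slice_holomorphic[OF f, of ?S 0 z] by simp
qed (use \<Omega> in auto)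

lemma higher_deriv_scalar_times_id:
  fixes f :: "complex^'n \<Rightarrow> complex"
  assumes \<Omega>: "open \<Omega>" "0 \<in> \<Omega>" and f: "holo_on (*) f \<Omega>"
  shows "higher_deriv (\<lambda>z. f z *s z) (replicate (Suc m) z) 0 =
    (of_nat (Suc m) * (deriv ^^ m) (\<lambda>\<zeta>. f (\<zeta> *s z)) 0) *s z"
proof -
  let ?g = "\<lambda>\<zeta>. f (\<zeta> *s z)"
  obtain S where S: "open S" "0 \<in> S" "?g holomorphic_on S"
    using slice_holomorphic_near_0[OF \<Omega> f] by metis
  have g: "?g has_fps_expansion fps_expansion ?g 0"
    using S by (rule has_fps_expansion_fps_expansion)
  have comp: "holo_on (*) (\<lambda>z. (f z *s z) $ i) \<Omega>" for i
    using holo_on_mult[OF f holo_on_nth] by simp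
  have "higher_deriv (\<lambda>z. f z *s z) (replicate (Suc m) z) 0 $ i
      = (of_nat (Suc m) * (deriv ^^ m) ?g 0) * z $ i" for i
  proof -
    have "higher_deriv (\<lambda>z. f z *s z) (replicate (Suc m) z) 0 $ i
      = (deriv ^^ Suc m) (\<lambda>\<zeta>. (f (\<zeta> *s z) *s (\<zeta> *s z)) $ i) 0"
    proof -
      have "higher_deriv (\<lambda>z. f z *s z) (replicate (Suc m) z) 0 $ i
        = higher_deriv (\<lambda>z. (f z *s z) $ i) (replicate (Suc m) z) (0 *s z)"
        by (simp only: higher_deriv_nth[OF \<Omega>(1) comp \<Omega>(2)] vector_smult_lzero)
      also have "\<dots> = (deriv ^^ Suc m) (\<lambda>\<zeta>. (f (\<zeta> *s z) *s (\<zeta> *s z)) $ i) 0"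
        using \<Omega>(2) by (intro higher_deriv_slice[OF \<Omega>(1) comp, symmetric]) simp
      finally show ?thesis .
    qed
    also have "(\<lambda>\<zeta>. (f (\<zeta> *s z) *s (\<zeta> *s z)) $ i) = (\<lambda>\<zeta>. z $ i * (\<zeta> * ?g \<zeta>))"
      by (simp add: mult_ac)
    also have "(deriv ^^ Suc m) \<dots> 0 = fact (Suc m) * fps_nth (fps_const (z $ i) * (fps_X * fps_expansion ?g 0)) (Suc m)"
    proof -
      have "(\<lambda>\<zeta>. z $ i * (\<zeta> * ?g \<zeta>)) has_fps_expansion fps_const (z $ i) * (fps_X * fps_expansion ?g 0)"
        by (intro fps_expansion_intros g)
      from fps_nth_fps_expansion[OF this, of "Suc m"] show ?thesis
        by (simp only: times_divide_eq_right nonzero_mult_div_cancel_left[OF fact_nonzero])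
    qed
    also have "\<dots> = fact (Suc m) * (z $ i * ((deriv ^^ m) ?g 0 / fact m))"
      by (simp add: fps_expansion_def del: fact_Suc)
    also have "\<dots> = (of_nat (Suc m) * (deriv ^^ m) ?g 0) * z $ i"
      by (simp add: field_simps del: of_nat_Suc)
    finally show ?thesis .
  qed
  then show ?thesis by (simp add: vec_eq_iff)
qed

lemma normalized_coeff_scalar_times_id:
  fixes f :: "complex^'n \<Rightarrow> complex"
  assumes dom: "starlike_circular_domain \<Omega> \<rho>" and \<Omega>: "0 \<in> \<Omega>" and f: "holo_on (*) f \<Omega>"
    and diff: "\<rho> differentiable (at z)" and z: "z \<noteq> 0"
  shows "normalized_coeff \<rho> (\<lambda>z. f z *s z) (Suc m) z =
    (deriv ^^ m) (\<lambda>\<zeta>. f (\<zeta> *s (of_real (1 / \<rho> z) *s z))) 0 / fact m"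
proof -
  have op: "open \<Omega>" using dom unfolding starlike_circular_domain_def by blast
  have pos: "\<rho> z > 0" using starlike_circular_domain_pos[OF dom z] .
  let ?g = "\<lambda>\<zeta>. f (\<zeta> *s z)"
  obtain S where S: "open S" "0 \<in> S" "?g holomorphic_on S"
    using slice_holomorphic_near_0[OF op \<Omega> f] by metis
  define u where "u = complex_of_real (1 / \<rho> z)"
  have u: "u \<noteq> 0" using pos by (simp add: u_def)
  have "(deriv ^^ m) (\<lambda>\<zeta>. ?g (u * \<zeta>)) 0 = u ^ m * (deriv ^^ m) ?g (u * 0)"
  proof (rule higher_deriv_compose_linear[OF S(3)])
    show "open ((\<lambda>\<zeta>. u * \<zeta>) -` S)" using S(1) by (intro continuous_open_vimage continuous_intros)
  qed (use S in auto)
  moreover have "(\<lambda>\<zeta>. ?g (u * \<zeta>)) = (\<lambda>\<zeta>. f (\<zeta> *s (u *s z)))"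
    by (simp add: vector_smult_assoc mult.commute)
  ultimately have "(deriv ^^ m) (\<lambda>\<zeta>. f (\<zeta> *s (u *s z))) 0 = (deriv ^^ m) ?g 0 / of_real (\<rho> z) ^ m"
    by (simp add: u_def field_simps power_divide)
  moreover have "normalized_coeff \<rho> (\<lambda>z. f z *s z) (Suc m) z
     = (deriv ^^ m) ?g 0 / of_real (\<rho> z) ^ m / fact m"
    unfolding normalized_coeff_def higher_deriv_scalar_times_id[OF op \<Omega> f] scalar_product_scale
      scalar_product_wirtinger_self[OF dom diff]
    using pos by (simp add: field_simps del: of_nat_Suc)
  ultimately show ?thesis by (simp add: u_def)
qed

lemma dense_Compl_meets_open:
  assumes "closure (- E) = UNIV" "open U" "z \<in> U"
  obtains y where "y \<in> U" "y \<notin> E"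
  using assms closure_iff_nhds_not_empty[of z "- E"] by (metis ComplD UNIV_I disjoint_iff order_refl)

lemma starlike_quantity:
  fixes f :: "complex^'n \<Rightarrow> complex"
  assumes dom: "starlike_circular_domain \<Omega> \<rho>" and f: "holo_on (*) f \<Omega>" and z: "z \<in> \<Omega>"
    and diff: "\<rho> differentiable (at z)"
    and inj: "inj (frechet_derivative (\<lambda>z. f z *s z) (at z))"
    and nz: "f z + frechet_derivative f (at z) z \<noteq> 0"
  shows "Re (scalar_product (wirtinger \<rho> z) (inv (frechet_derivative (\<lambda>z. f z *s z) (at z)) (f z *s z)))
    = \<rho> z / 2 * Re (f z / (f z + frechet_derivative f (at z) z))"
proof -
  let ?D = "frechet_derivative (\<lambda>z. f z *s z) (at z)"
  define c where "c = f z / (f z + frechet_derivative f (at z) z)"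
  have cN: "c * (f z + frechet_derivative f (at z) z) = f z" using nz by (simp add: c_def)
  have "?D (c *s z) = (c * (f z + frechet_derivative f (at z) z)) *s z"
    unfolding frechet_derivative_scalar_times_id[OF f z]
    by (simp add: holo_on_frechet_derivative(2)[OF f z] vec_eq_iff algebra_simps)
  then have "inv ?D (f z *s z) = c *s z" unfolding cN using inv_f_eq[OF inj] by blast
  then show ?thesis
    unfolding c_def[symmetric] by (simp add: scalar_product_scale scalar_product_wirtinger_self[OF dom diff])
qed

lemma radial_derivative_continuous:
  fixes f :: "complex^'n \<Rightarrow> complex"
  assumes "open \<Omega>" and f: "holo_on (*) f \<Omega>"
  shows "continuous_on \<Omega> (\<lambda>z. frechet_derivative f (at z) z)"
proof -
  have "frechet_derivative f (at z) z = (\<Sum>i\<in>UNIV. z $ i * frechet_derivative f (at z) (axis i 1))"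
    if z: "z \<in> \<Omega>" for z
  proof -
    have lin: "linear (frechet_derivative f (at z))"
      using holo_on_frechet_derivative(1)[OF f z] by (rule has_derivative_linear)
    have "frechet_derivative f (at z) z = frechet_derivative f (at z) (\<Sum>i\<in>UNIV. z $ i *s axis i 1)"
      by (simp add: basis_expansion)
    then show ?thesis
      by (simp add: linear_sum[OF lin] holo_on_frechet_derivative(2)[OF f z])
  qed
  moreover have "continuous_on \<Omega> (\<lambda>z. \<Sum>i\<in>UNIV. z $ i * frechet_derivative f (at z) (axis i 1))"
    by (intro continuous_intros holo_on_imp_continuous_on[OF holo_on_directional[OF assms]])
  ultimately show ?thesis by (simp cong: continuous_on_cong)
qed

lemma C1_on_imp_differentiable: "C1_on \<rho> S \<Longrightarrow> z \<in> S \<Longrightarrow> \<rho> differentiable (at z)"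
  unfolding C1_on_def differentiable_def by blast

lemma unit_multiple:
  assumes "starlike_circular_domain \<Omega> \<rho>" "z \<noteq> 0"
  shows "\<rho> (of_real (1 / \<rho> z) *s z) = 1"
  using starlike_circular_domain_pos[OF assms] starlike_circular_domain_scale[OF assms(1)]
  by (simp add: norm_divide)

lemma starlike_mapping_slice:
  fixes f :: "complex^'n \<Rightarrow> complex"
  assumes dom: "starlike_circular_domain \<Omega> \<rho>" and \<Omega>0: "0 \<in> \<Omega>"
    and dense: "closure (- E) = UNIV" and C1: "C1_on \<rho> (- E)"
    and f: "holo_on (*) f \<Omega>" and F: "(\<lambda>z. f z *s z) \<in> starlike_mappings \<Omega> \<rho> E"
  shows "f 0 = 1" and "\<And>z. z \<in> \<Omega> \<Longrightarrow> f z + frechet_derivative f (at z) z \<noteq> 0"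
    and "\<And>z. z \<in> \<Omega> \<Longrightarrow> Re (f z / (f z + frechet_derivative f (at z) z)) \<ge> 0"
proof -
  let ?D = "\<lambda>z. frechet_derivative (\<lambda>z. f z *s z) (at z)"
  let ?N = "\<lambda>z. f z + frechet_derivative f (at z) z"
  have op: "open \<Omega>" using dom unfolding starlike_circular_domain_def by blast
  have Fid: "?D 0 = id" and bij: "\<And>z. z \<in> \<Omega> \<Longrightarrow> bij (?D z)"
    and pos: "\<And>z. z \<in> \<Omega> - E \<Longrightarrow>
      Re (scalar_product (wirtinger \<rho> z) (inv (?D z) (f z *s z))) > 0"
    using F unfolding starlike_mappings_def by auto
  have "f 0 *s axis undefined 1 = (axis undefined 1 :: complex^'n)"
    using fun_cong[OF Fid, of "axis undefined 1"]
    unfolding frechet_derivative_scalar_times_id[OF f \<Omega>0] by simp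
  then have "(f 0 *s (axis undefined 1 :: complex^'n)) $ undefined = axis undefined 1 $ undefined" by simp
  then show f0: "f 0 = 1" by (simp add: axis_def)
  show N: "?N z \<noteq> 0" if z: "z \<in> \<Omega>" for z
  proof (cases "z = 0")
    case True
    then show ?thesis
      using holo_on_frechet_derivative(2)[OF f z, of 0 0] f0 by simp
  next
    case False
    have "?D z z \<noteq> ?D z 0"
      using bij[OF z] False by (auto simp: bij_def dest: injD)
    moreover have "?D z z = ?N z *s z" "?D z 0 = 0"
      unfolding frechet_derivative_scalar_times_id[OF f z]
      using holo_on_frechet_derivative(2)[OF f z, of 0 0] by (simp_all add: vec_eq_iff algebra_simps)
    ultimately show ?thesis by (metis vector_smult_lzero)
  qed
  have cont: "continuous_on \<Omega> (\<lambda>z. Re (f z / ?N z))"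
    using N by (intro continuous_intros holo_on_imp_continuous_on[OF f] radial_derivative_continuous[OF op f]) auto
  show "Re (f z / ?N z) \<ge> 0" if z: "z \<in> \<Omega>" for z
  proof (rule ccontr)
    assume neg: "\<not> Re (f z / ?N z) \<ge> 0"
    define U where "U = \<Omega> \<inter> (\<lambda>z. Re (f z / ?N z)) -` {..<0}"
    have "open U" unfolding U_def
      using continuous_open_preimage[OF cont op, of "{..<0}"] by auto
    moreover have "z \<in> U" using neg z by (simp add: U_def)
    ultimately obtain y where y: "y \<in> U" "y \<notin> E" using dense_Compl_meets_open[OF dense] by blast
    then have y\<Omega>: "y \<in> \<Omega>" and neg_y: "Re (f y / ?N y) < 0" by (auto simp: U_def)
    have diff: "\<rho> differentiable (at y)" using C1_on_imp_differentiable[OF C1] y by blast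
    have "0 < \<rho> y / 2 * Re (f y / ?N y)"
      using pos[of y] y y\<Omega> starlike_quantity[OF dom f y\<Omega> diff bij_is_inj[OF bij[OF y\<Omega>]] N[OF y\<Omega>]]
      by simp
    moreover have "\<rho> y \<ge> 0" using dom unfolding starlike_circular_domain_def by blast
    ultimately show False using neg_y by (smt (verit) mult_nonneg_nonpos half_gt_zero_iff zero_le_divide_iff)
  qed
qed

lemma starlike_mapping_coeff_bounds:
  fixes f :: "complex^'n \<Rightarrow> complex"
  assumes dom: "starlike_circular_domain \<Omega> \<rho>" and \<Omega>0: "0 \<in> \<Omega>"
    and dense: "closure (- E) = UNIV" and C1: "C1_on \<rho> (- E)" and k: "k \<ge> 1"
    and f: "holo_on (*) f \<Omega>" and F: "(\<lambda>z. f z *s z) \<in> starlike_mappings \<Omega> \<rho> E"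
    and ord: "zero_of_order (k + 1) (\<lambda>z. f z *s z - z)" and z: "z \<in> \<Omega> - E"
  shows "cmod (normalized_coeff \<rho> (\<lambda>z. f z *s z) (k + 1) z) \<le> 2 / real k"
    and "cmod (normalized_coeff \<rho> (\<lambda>z. f z *s z) (2 * k + 1) z) \<le> (real k + 2) / (real k)\<^sup>2"
proof -
  note slice = starlike_mapping_slice[OF dom \<Omega>0 dense C1 f F]
  have op: "open \<Omega>" using dom unfolding starlike_circular_domain_def by blast
  have diff: "\<rho> differentiable (at z)" using C1_on_imp_differentiable[OF C1] z by blast
  have z0: "z \<noteq> 0" using diff minkowski_not_differentiable_0[OF dom] by blast
  define u where "u = complex_of_real (1 / \<rho> z) *s z"
  have \<rho>u: "\<rho> u = 1" unfolding u_def by (rule unit_multiple[OF dom z0])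
  have "\<rho> 0 = 0" using dom unfolding starlike_circular_domain_def by blast
  then have u0: "u \<noteq> 0" using \<rho>u by auto
  have in\<Omega>: "\<zeta> *s u \<in> \<Omega>" if "\<zeta> \<in> ball 0 1" for \<zeta>
    using that starlike_circular_domain_iff[OF dom] starlike_circular_domain_scale[OF dom] \<rho>u by simp
  define g where "g = (\<lambda>\<zeta>. f (\<zeta> *s u))"
  have g: "g holomorphic_on ball 0 1"
    unfolding g_def using holo_on_slice_holomorphic[OF f, of "ball 0 1" 0 u] in\<Omega> by simp
  have dg: "\<zeta> * deriv g \<zeta> = frechet_derivative f (at (\<zeta> *s u)) (\<zeta> *s u)" if \<zeta>: "\<zeta> \<in> ball 0 1" for \<zeta>
    using DERIV_imp_deriv[OF holo_on_slice_derivative[OF f, of 0 \<zeta> u]] in\<Omega>[OF \<zeta>]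
      holo_on_frechet_derivative(2)[OF f in\<Omega>[OF \<zeta>]] by (simp add: g_def)
  have van: "(deriv ^^ j) g 0 = 0" if j: "1 \<le> j" "j < k" for j
  proof -
    have "\<And>hs. length hs < k + 1 \<Longrightarrow> higher_deriv (\<lambda>z. f z *s z - z) hs 0 = 0"
      using ord unfolding zero_of_order_def by blast
    then have "higher_deriv (\<lambda>z. f z *s z - z) (replicate (Suc j) u) 0 = 0"
      by this (use j in simp)
    moreover have "(\<lambda>z. f z *s z - z) = (\<lambda>z. (f z - 1) *s z)"
      by (rule ext) (simp add: vec_eq_iff algebra_simps)
    ultimately have "higher_deriv (\<lambda>z. (f z - 1) *s z) (replicate (Suc j) u) 0 = 0" by (simp only:)
    then have "(of_nat (Suc j) * (deriv ^^ j) (\<lambda>\<zeta>. g \<zeta> - 1) 0) *s u = 0"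
      unfolding higher_deriv_scalar_times_id[OF op \<Omega>0 holo_on_diff_const[OF f]] g_def .
    then have "(deriv ^^ j) (\<lambda>\<zeta>. g \<zeta> - 1) 0 = 0"
      using u0 by (simp add: vector_mul_eq_0 del: of_nat_Suc)
    moreover have "(deriv ^^ j) (\<lambda>\<zeta>. g \<zeta> - 1) 0 = (deriv ^^ j) g 0 - (deriv ^^ j) (\<lambda>\<zeta>. 1) 0"
      by (rule higher_deriv_diff[OF g]) auto
    ultimately show ?thesis using j by simp
  qed
  have bounds: "cmod ((deriv ^^ k) g 0 / fact k) \<le> 2 / real k"
    "cmod ((deriv ^^ (2 * k)) g 0 / fact (2 * k)) \<le> (real k + 2) / (real k)\<^sup>2"
  proof -
    have g0: "g 0 = 1" using slice(1) by (simp add: g_def)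
    have nz: "g \<zeta> + \<zeta> * deriv g \<zeta> \<noteq> 0" if "\<zeta> \<in> ball 0 1" for \<zeta>
      using slice(2)[OF in\<Omega>[OF that]] unfolding dg[OF that] by (simp add: g_def)
    have Re: "Re (g \<zeta> / (g \<zeta> + \<zeta> * deriv g \<zeta>)) \<ge> 0" if "\<zeta> \<in> ball 0 1" for \<zeta>
      using slice(3)[OF in\<Omega>[OF that]] unfolding dg[OF that] by (simp add: g_def)
    show "cmod ((deriv ^^ k) g 0 / fact k) \<le> 2 / real k"
      by (rule starlike_disc_coeff_bounds(1)[OF g g0 k van nz Re])
    show "cmod ((deriv ^^ (2 * k)) g 0 / fact (2 * k)) \<le> (real k + 2) / (real k)\<^sup>2"
      by (rule starlike_disc_coeff_bounds(2)[OF g g0 k van nz Re])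
  qed
  have coeff: "normalized_coeff \<rho> (\<lambda>z. f z *s z) (m + 1) z = (deriv ^^ m) g 0 / fact m" for m
    using normalized_coeff_scalar_times_id[OF dom \<Omega>0 f diff z0, of m] by (simp add: g_def u_def)
  show "cmod (normalized_coeff \<rho> (\<lambda>z. f z *s z) (k + 1) z) \<le> 2 / real k"
    "cmod (normalized_coeff \<rho> (\<lambda>z. f z *s z) (2 * k + 1) z) \<le> (real k + 2) / (real k)\<^sup>2"
    using bounds unfolding coeff by auto
qed

lemma norm_diff_squares_bound:
  assumes a: "cmod a \<le> (real k + 2) / (real k)\<^sup>2" and b: "cmod b \<le> 2 / real k"
  shows "cmod (a\<^sup>2 - b\<^sup>2) \<le> (real k + 2)\<^sup>2 / real k ^ 4 + 4 / (real k)\<^sup>2"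
proof -
  have "cmod (a\<^sup>2 - b\<^sup>2) \<le> (cmod a)\<^sup>2 + (cmod b)\<^sup>2"
    using norm_triangle_ineq4[of "a\<^sup>2" "b\<^sup>2"] by (simp add: norm_power)
  also have "\<dots> \<le> ((real k + 2) / (real k)\<^sup>2)\<^sup>2 + (2 / real k)\<^sup>2"
    using a b by (intro add_mono power_mono) auto
  also have "\<dots> = (real k + 2)\<^sup>2 / real k ^ 4 + 4 / (real k)\<^sup>2"
    by (simp add: power_divide flip: power_mult)
  finally show ?thesis .
qed

section \<open>Extremal mappings\<close>

definition koebe_factor :: "nat \<Rightarrow> complex \<Rightarrow> complex" where
  "koebe_factor k w = exp (- (2 / of_nat k) * Ln (1 - \<i> * w ^ k))"

lemma one_minus_not_nonpos_Reals: "cmod x < 1 \<Longrightarrow> 1 - x \<notin> \<real>\<^sub>\<le>\<^sub>0"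
  using complex_Re_le_cmod[of x] by (auto simp: complex_nonpos_Reals_iff)

lemma koebe_factor_derivative:
  assumes k: "k \<ge> 1" and w: "cmod w < 1"
  shows "(koebe_factor k has_field_derivative
    2 * \<i> * w ^ (k - 1) / (1 - \<i> * w ^ k) * koebe_factor k w) (at w)"
proof -
  have "cmod (\<i> * w ^ k) < 1"
    using w k by (simp add: norm_mult norm_power power_less_one_iff)
  then have notin: "1 - \<i> * w ^ k \<notin> \<real>\<^sub>\<le>\<^sub>0" by (rule one_minus_not_nonpos_Reals)
  have k0: "complex_of_nat k \<noteq> 0" using k by simp
  show ?thesis
    unfolding koebe_factor_def[abs_def]
    by (rule derivative_eq_intros refl notin)+ (use notin k0 in \<open>simp add: field_simps\<close>)
qed

lemma koebe_factor_ode: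
  assumes k: "k \<ge> 1" and w: "cmod w < 1"
  shows "w * deriv (koebe_factor k) w * (1 - \<i> * w ^ k) = 2 * \<i> * w ^ k * koebe_factor k w"
proof -
  have "cmod (\<i> * w ^ k) < 1"
    using w k by (simp add: norm_mult norm_power power_less_one_iff)
  then have nz: "1 - \<i> * w ^ k \<noteq> 0" using one_minus_not_nonpos_Reals by force
  have "w * w ^ (k - 1) = w ^ k" using k by (simp add: power_eq_if)
  then show ?thesis
    using nz unfolding DERIV_imp_deriv[OF koebe_factor_derivative[OF assms]]
    by (simp add: mult_ac)
qed

lemma koebe_factor_0: "k \<ge> 1 \<Longrightarrow> koebe_factor k 0 = 1"
  by (simp add: koebe_factor_def power_0_left)

lemma koebe_factor_minus_1_bound:
  assumes k: "k \<ge> 1"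
  shows "\<exists>C r. 0 < r \<and> 0 \<le> C \<and> (\<forall>w. cmod w < r \<longrightarrow> cmod (koebe_factor k w - 1) \<le> C * cmod w ^ k)"
proof -
  define \<psi> where "\<psi> = (\<lambda>x. exp (- (2 / of_nat k) * Ln (1 - \<i> * x)))"
  have \<psi>0: "\<psi> 0 = 1" by (simp add: \<psi>_def)
  obtain D where "(\<psi> has_field_derivative D) (at 0)"
  proof
    have "((\<lambda>x. 1 - \<i> * x) has_field_derivative - \<i>) (at 0)"
      by (auto intro!: derivative_eq_intros)
    then have "((\<lambda>x. Ln (1 - \<i> * x)) has_field_derivative inverse (1 - \<i> * 0) * (- \<i>)) (at 0)"
      by (intro DERIV_chain2[where f = Ln] has_field_derivative_Ln) auto
    then show "(\<psi> has_field_derivative exp (- (2 / of_nat k) * Ln (1 - \<i> * 0)) *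
        (- (2 / of_nat k) * (inverse (1 - \<i> * 0) * (- \<i>)))) (at 0)"
      unfolding \<psi>_def by (intro DERIV_chain2[OF DERIV_exp] DERIV_cmult)
  qed
  then have "(\<lambda>x. (\<psi> x - 1) / x) \<midarrow>0\<rightarrow> D"
    unfolding has_field_derivative_iff \<psi>0 by simp
  then have "\<forall>\<^sub>F x in at 0. dist ((\<psi> x - 1) / x) D < 1" by (rule tendstoD) simp
  then obtain r where r: "r > 0" "\<And>x. x \<noteq> 0 \<Longrightarrow> cmod x < r \<Longrightarrow> dist ((\<psi> x - 1) / x) D < 1"
    unfolding eventually_at by (auto simp: dist_norm)
  have bd: "cmod (\<psi> x - 1) \<le> (cmod D + 1) * cmod x" if x: "cmod x < r" for x
  proof (cases "x = 0")
    case False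
    have "cmod ((\<psi> x - 1) / x) \<le> cmod D + 1"
      using r(2)[OF False x] norm_triangle_sub[of "(\<psi> x - 1) / x" D] by (simp add: dist_norm)
    then show ?thesis using False by (simp add: norm_divide field_simps)
  qed (simp add: \<psi>0)
  have "cmod (koebe_factor k w - 1) \<le> (cmod D + 1) * cmod w ^ k" if w: "cmod w < min r 1" for w
  proof -
    have "cmod w ^ k \<le> cmod w ^ 1" using w k by (intro power_decreasing) auto
    then have "cmod (w ^ k) < r" using w by (simp add: norm_power)
    from bd[OF this] show ?thesis by (simp add: koebe_factor_def \<psi>_def norm_power)
  qed
  moreover have "0 < min r 1" "0 \<le> cmod D + 1" using r by auto
  ultimately show ?thesis by blast
qed

lemma koebe_factor_slice_coeffs:
  assumes k: "k \<ge> 1" and t: "cmod t \<le> 1"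
  shows "(deriv ^^ k) (\<lambda>\<zeta>. koebe_factor k (\<zeta> * t)) 0 / fact k = 2 * (\<i> * t ^ k) / of_nat k"
    and "(deriv ^^ (2 * k)) (\<lambda>\<zeta>. koebe_factor k (\<zeta> * t)) 0 / fact (2 * k)
      = (\<i> * t ^ k)\<^sup>2 * (of_nat k + 2) / (of_nat k)\<^sup>2"
proof -
  let ?g = "\<lambda>\<zeta>. koebe_factor k (\<zeta> * t)"
  have lt: "cmod (\<zeta> * t) < 1" if "\<zeta> \<in> ball 0 1" for \<zeta>
    using that mult_left_mono[OF t norm_ge_zero[of \<zeta>]] by (simp add: norm_mult)
  have der: "(?g has_field_derivative deriv (koebe_factor k) (\<zeta> * t) * t) (at \<zeta>)" if "\<zeta> \<in> ball 0 1" for \<zeta>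
  proof -
    have "(koebe_factor k has_field_derivative deriv (koebe_factor k) (\<zeta> * t)) (at (\<zeta> * t))"
      using DERIV_deriv_iff_field_differentiable koebe_factor_derivative[OF k lt[OF that]]
        field_differentiable_def by blast
    moreover have "((\<lambda>\<zeta>. \<zeta> * t) has_field_derivative t) (at \<zeta>)"
      by (auto intro!: derivative_eq_intros)
    ultimately show ?thesis by (rule DERIV_chain2)
  qed
  have g: "?g holomorphic_on ball 0 1"
    unfolding holomorphic_on_open[OF open_ball] using der by blast
  have g0: "?g 0 = 1" using koebe_factor_0[OF k] by simp
  have ode: "\<zeta> * deriv ?g \<zeta> * (1 - \<i> * t ^ k * \<zeta> ^ k) = 2 * (\<i> * t ^ k) * \<zeta> ^ k * ?g \<zeta>"
    if "\<zeta> \<in> ball 0 1" for \<zeta>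
    using koebe_factor_ode[OF k lt[OF that]] unfolding DERIV_imp_deriv[OF der[OF that]]
    by (simp add: power_mult_distrib mult_ac)
  show "(deriv ^^ k) ?g 0 / fact k = 2 * (\<i> * t ^ k) / of_nat k"
    by (rule Koebe_type_coeffs(1)[OF g k g0 ode])
  show "(deriv ^^ (2 * k)) ?g 0 / fact (2 * k) = (\<i> * t ^ k)\<^sup>2 * (of_nat k + 2) / (of_nat k)\<^sup>2"
    by (rule Koebe_type_coeffs(2)[OF g k g0 ode])
qed

lemma Re_Cayley_pos:
  assumes "cmod x < 1"
  shows "Re ((1 - x) / (1 + x)) > 0" and "1 + x \<noteq> 0"
proof -
  show nz: "1 + x \<noteq> 0" using assms by (metis add.inverse_unique norm_minus_cancel norm_one less_irrefl)
  have "Re ((1 - x) * cnj (1 + x)) = 1 - (cmod x)\<^sup>2"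
    unfolding cmod_power2 by (simp add: algebra_simps power2_eq_square)
  then show "Re ((1 - x) / (1 + x)) > 0"
    unfolding Re_complex_div_gt_0 using assms by (simp add: power_less_one_iff)
qed

text \<open>
  The domain need not be convex, so a linear form bounded by \<open>\<rho>\<close> that attains the bound exists
  only at suitable points; a maximum point of a coordinate on \<open>{\<rho> = 1}\<close> is one.
\<close>

lemma supporting_coordinate:
  assumes dom: "starlike_circular_domain \<Omega> (\<rho> :: complex^'n \<Rightarrow> real)"
  obtains i u where "\<rho> u = 1" "u $ i \<noteq> 0" "\<And>z. cmod (z $ i / u $ i) \<le> \<rho> z"
proof -
  have cont: "continuous_on UNIV \<rho>" and bd: "bounded \<Omega>" using dom unfolding starlike_circular_domain_def by auto
  define i :: 'n where "i = undefined"
  let ?K = "{z. \<rho> z = 1}"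
  have "closed ?K"
    using closed_Collect_eq[OF cont continuous_on_const] by simp
  moreover have "bounded ?K"
  proof -
    obtain B where B: "\<And>z. z \<in> \<Omega> \<Longrightarrow> norm z \<le> B" using bd bounded_iff by blast
    have "norm z \<le> 2 * B" if "\<rho> z = 1" for z
    proof -
      have "(1 / 2) *s z \<in> \<Omega>"
        using starlike_circular_domain_iff[OF dom] starlike_circular_domain_scale[OF dom] that
        by (simp add: norm_divide)
      from B[OF this] show ?thesis by (simp add: norm_vector_scalar_mult norm_divide)
    qed
    then show ?thesis unfolding bounded_iff by blast
  qed
  ultimately have "compact ?K" using compact_eq_bounded_closed by blast
  moreover have axis0: "(axis i 1 :: complex^'n) \<noteq> 0" by (simp add: axis_eq_0_iff)
  then have K1: "of_real (1 / \<rho> (axis i 1)) *s axis i 1 \<in> ?K"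
    using unit_multiple[OF dom] by blast
  moreover have "continuous_on ?K (\<lambda>z. cmod (z $ i))" by (intro continuous_intros)
  ultimately obtain u where u: "u \<in> ?K" "\<And>z. z \<in> ?K \<Longrightarrow> cmod (z $ i) \<le> cmod (u $ i)"
    using continuous_attains_sup[of ?K] by blast
  have "cmod ((of_real (1 / \<rho> (axis i 1)) *s axis i 1 :: complex^'n) $ i) > 0"
    using starlike_circular_domain_pos[OF dom axis0] by simp
  then have ui: "cmod (u $ i) > 0" using u(2)[OF K1] by linarith
  have "cmod (z $ i / u $ i) \<le> \<rho> z" for z
  proof (cases "z = 0")
    case True
    then show ?thesis using dom unfolding starlike_circular_domain_def by simp
  next
    case False
    have "of_real (1 / \<rho> z) *s z \<in> ?K" using unit_multiple[OF dom False] by simp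
    from u(2)[OF this] have "cmod (z $ i) / \<rho> z \<le> cmod (u $ i)"
      using starlike_circular_domain_pos[OF dom False] by (simp add: norm_divide)
    then show ?thesis
      using starlike_circular_domain_pos[OF dom False] ui by (simp add: norm_divide field_simps)
  qed
  with u ui that show ?thesis by auto
qed

lemma extremal_derivative:
  fixes z :: "complex^'n"
  assumes k: "k \<ge> 1" and lt: "cmod (z $ i / a) < 1"
  shows "((\<lambda>z. koebe_factor k (z $ i / a)) has_derivative
    (\<lambda>v. deriv (koebe_factor k) (z $ i / a) * (v $ i / a))) (at z)"
proof -
  have "(koebe_factor k has_field_derivative deriv (koebe_factor k) (z $ i / a)) (at (z $ i / a))"
    using DERIV_deriv_iff_field_differentiable koebe_factor_derivative[OF k lt]
      field_differentiable_def by blast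
  then have 1: "(koebe_factor k has_derivative (*) (deriv (koebe_factor k) (z $ i / a))) (at (z $ i / a))"
    by (simp add: has_field_derivative_def)
  have "((\<lambda>z :: complex^'n. z $ i / a) has_derivative (\<lambda>v. v $ i / a)) (at z)"
    by (intro bounded_linear.has_derivative[OF bounded_linear_divide]
        bounded_linear.has_derivative[OF bounded_linear_vec_nth] has_derivative_ident)
  from has_derivative_compose[OF this 1] show ?thesis .
qed

lemma extremal_facts:
  fixes \<rho> :: "complex^'n \<Rightarrow> real"
  assumes dom: "starlike_circular_domain \<Omega> \<rho>" and k: "k \<ge> 1"
    and le: "\<And>z. cmod (z $ i / a) \<le> \<rho> z"
  defines "f \<equiv> \<lambda>z. koebe_factor k (z $ i / a)"
  shows "holo_on (*) f \<Omega>"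
    and "\<And>z. z \<in> \<Omega> \<Longrightarrow> f z + frechet_derivative f (at z) z \<noteq> 0"
    and "\<And>z. z \<in> \<Omega> \<Longrightarrow> Re (f z / (f z + frechet_derivative f (at z) z)) > 0"
proof -
  have lt: "cmod (z $ i / a) < 1" if "z \<in> \<Omega>" for z
    using le[of z] that starlike_circular_domain_iff[OF dom] by simp
  have der: "(f has_derivative (\<lambda>v. deriv (koebe_factor k) (z $ i / a) * (v $ i / a))) (at z)"
    if "z \<in> \<Omega>" for z
    unfolding f_def by (rule extremal_derivative[OF k lt[OF that]])
  show "holo_on (*) f \<Omega>"
    unfolding holo_on_def
  proof
    fix z assume z: "z \<in> \<Omega>"
    show "\<exists>f'. (f has_derivative f') (at z) \<and> (\<forall>c v. f' (c *s v) = c * f' v)"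
      by (rule exI, rule conjI, rule der[OF z]) simp
  qed
  fix z assume z: "z \<in> \<Omega>"
  define w where "w = z $ i / a"
  define x where "x = \<i> * w ^ k"
  have x: "cmod x < 1"
    using lt[OF z] k by (simp add: x_def w_def norm_mult norm_power power_less_one_iff)
  have nz: "1 - x \<noteq> 0" "1 + x \<noteq> 0" using Re_Cayley_pos(2)[of x] Re_Cayley_pos(2)[of "-x"] x by auto
  have fz: "f z \<noteq> 0" by (simp add: f_def koebe_factor_def)
  have "frechet_derivative f (at z) z = w * deriv (koebe_factor k) w"
    using frechet_derivative_at[OF der[OF z]] by (metis w_def mult.commute)
  then have "frechet_derivative f (at z) z * (1 - x) = 2 * x * f z"
    using koebe_factor_ode[OF k lt[OF z]] by (simp add: f_def w_def x_def mult_ac)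
  then have N: "(f z + frechet_derivative f (at z) z) * (1 - x) = f z * (1 + x)"
    by (simp add: algebra_simps)
  then show N0: "f z + frechet_derivative f (at z) z \<noteq> 0" using fz nz by force
  have "f z / (f z + frechet_derivative f (at z) z) = (1 - x) / (1 + x)"
    using N N0 nz by (simp add: frac_eq_eq mult_ac)
  then show "Re (f z / (f z + frechet_derivative f (at z) z)) > 0"
    using Re_Cayley_pos(1)[OF x] by simp
qed

lemma extremal_starlike:
  fixes \<rho> :: "complex^'n \<Rightarrow> real"
  assumes dom: "starlike_circular_domain \<Omega> \<rho>" and \<Omega>0: "0 \<in> \<Omega>" and k: "k \<ge> 1"
    and C1: "C1_on \<rho> (- E)" and le: "\<And>z. cmod (z $ i / a) \<le> \<rho> z"
  shows "(\<lambda>z. koebe_factor k (z $ i / a) *s z) \<in> starlike_mappings \<Omega> \<rho> E"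
proof -
  define f where "f = (\<lambda>z :: complex^'n. koebe_factor k (z $ i / a))"
  let ?D = "\<lambda>z. frechet_derivative (\<lambda>z. f z *s z) (at z)"
  have f: "holo_on (*) f \<Omega>" and N: "\<And>z. z \<in> \<Omega> \<Longrightarrow> f z + frechet_derivative f (at z) z \<noteq> 0"
    and P: "\<And>z. z \<in> \<Omega> \<Longrightarrow> Re (f z / (f z + frechet_derivative f (at z) z)) > 0"
    unfolding f_def by (rule extremal_facts[OF dom k le]; assumption)+
  have "holo_on (*s) (\<lambda>z. f z *s z) \<Omega>"
    unfolding holo_on_def
  proof
    fix z assume z: "z \<in> \<Omega>"
    show "\<exists>f'. ((\<lambda>z. f z *s z) has_derivative f') (at z) \<and> (\<forall>c v. f' (c *s v) = c *s f' v)"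
      using has_derivative_scalar_times_id[OF f z] holo_on_frechet_derivative(2)[OF f z]
      by (intro exI conjI) (assumption, simp add: vec_eq_iff algebra_simps)
  qed
  moreover have f0: "f 0 = 1" using koebe_factor_0[OF k] by (simp add: f_def)
  moreover have "?D 0 = id"
    unfolding frechet_derivative_scalar_times_id[OF f \<Omega>0] f0 by (rule ext) simp
  moreover have bij: "bij (?D z)" if z: "z \<in> \<Omega>" for z
  proof -
    have lin: "linear (?D z)"
      unfolding frechet_derivative_scalar_times_id[OF f z]
      using has_derivative_linear[OF has_derivative_scalar_times_id[OF f z]] .
    have "v = 0" if v: "?D z v = 0" for v
    proof -
      have eq: "f z *s v + frechet_derivative f (at z) v *s z = 0"
        using v unfolding frechet_derivative_scalar_times_id[OF f z] .
      have fz: "f z \<noteq> 0" by (simp add: f_def koebe_factor_def)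
      define c where "c = - frechet_derivative f (at z) v / f z"
      have vc: "v = c *s z"
        using eq fz by (simp add: c_def vec_eq_iff field_simps eq_neg_iff_add_eq_0)
      have "(c * (f z + frechet_derivative f (at z) z)) *s z = 0"
        using eq unfolding vc holo_on_frechet_derivative(2)[OF f z] by (simp add: vec_eq_iff algebra_simps)
      then show "v = 0" using N[OF z] unfolding vc vector_mul_eq_0 by auto
    qed
    then have "inj (?D z)" using linear_injective_0[OF lin] by blast
    then show ?thesis using linear_injective_imp_surjective[OF lin] by (simp add: bij_def)
  qed
  moreover have "Re (scalar_product (wirtinger \<rho> z) (inv (?D z) (f z *s z))) > 0" if z: "z \<in> \<Omega> - E" for z
  proof -
    have z\<Omega>: "z \<in> \<Omega>" using z by simp
    have diff: "\<rho> differentiable (at z)" using C1_on_imp_differentiable[OF C1] z by blast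
    then have "z \<noteq> 0" using minkowski_not_differentiable_0[OF dom] by blast
    then show ?thesis
      unfolding starlike_quantity[OF dom f z\<Omega> diff bij_is_inj[OF bij[OF z\<Omega>]] N[OF z\<Omega>]]
      using P[OF z\<Omega>] starlike_circular_domain_pos[OF dom] by simp
  qed
  ultimately have "(\<lambda>z. f z *s z) \<in> starlike_mappings \<Omega> \<rho> E"
    unfolding starlike_mappings_def by simp
  then show ?thesis by (simp add: f_def)
qed

lemma extremal_zero_of_order:
  fixes \<rho> :: "complex^'n \<Rightarrow> real"
  assumes dom: "starlike_circular_domain \<Omega> \<rho>" and \<Omega>0: "0 \<in> \<Omega>" and k: "k \<ge> 1"
    and u: "u $ i \<noteq> 0" and le: "\<And>z. cmod (z $ i / u $ i) \<le> \<rho> z"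
  shows "zero_of_order (k + 1) (\<lambda>z. koebe_factor k (z $ i / u $ i) *s z - z)"
proof -
  define f where "f = (\<lambda>z :: complex^'n. koebe_factor k (z $ i / u $ i))"
  note f = extremal_facts(1)[OF dom k le, folded f_def]
  have op: "open \<Omega>" using dom unfolding starlike_circular_domain_def by blast
  have f1: "holo_on (*) (\<lambda>z. f z - 1) \<Omega>" by (rule holo_on_diff_const[OF f])
  have eq: "(\<lambda>z. f z *s z - z) = (\<lambda>z. (f z - 1) *s z)"
    by (rule ext) (simp add: vec_eq_iff algebra_simps)
  have comp: "holo_on (*) (\<lambda>z. ((f z - 1) *s z) $ j) \<Omega>" for j
    using holo_on_mult[OF f1 holo_on_nth] by (simp only: vector_smult_component)
  obtain C r where C: "0 < r" "0 \<le> C"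
    "\<And>w. cmod w < r \<Longrightarrow> cmod (koebe_factor k w - 1) \<le> C * cmod w ^ k"
    using koebe_factor_minus_1_bound[OF k] by blast
  have van: "vanishes_to_order (k + 1) (\<lambda>z. ((f z - 1) *s z) $ j)" for j
  proof -
    let ?a = "cmod (u $ i)"
    have a: "?a > 0" using u by simp
    have "cmod (((f y - 1) *s y) $ j) \<le> (C / ?a ^ k) * norm y ^ (k + 1)" if y: "norm y < r * ?a" for y
    proof -
      have yi: "cmod (y $ i / u $ i) \<le> norm y / ?a"
        using Finite_Cartesian_Product.norm_nth_le[of y i] a by (simp add: norm_divide divide_right_mono)
      also have "\<dots> < r" using y a by (simp add: field_simps)
      finally have "cmod (f y - 1) \<le> C * cmod (y $ i / u $ i) ^ k" unfolding f_def by (rule C(3))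
      also have "\<dots> \<le> C * (norm y / ?a) ^ k"
        using yi C(2) by (intro mult_left_mono power_mono) auto
      finally have "cmod (f y - 1) * cmod (y $ j) \<le> C * (norm y / ?a) ^ k * norm y"
        using Finite_Cartesian_Product.norm_nth_le[of y j] C(2) a by (intro mult_mono) auto
      then show ?thesis unfolding vector_smult_component norm_mult by (simp add: power_divide mult_ac)
    qed
    moreover have "r * ?a > 0" using C(1) a by simp
    ultimately show ?thesis unfolding vanishes_to_order_def by blast
  qed
  have low: "higher_deriv (\<lambda>z. (f z - 1) *s z) hs 0 = 0" if "length hs < k + 1" for hs
    using higher_deriv_nth[OF op comp \<Omega>0] higher_deriv_0_eq_0[OF op \<Omega>0 comp van that]
    by (simp add: vec_eq_iff)
  have top: "higher_deriv (\<lambda>z. (f z - 1) *s z) (replicate (Suc k) u) 0 \<noteq> 0"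
  proof -
    have slice: "(\<lambda>\<zeta>. f (\<zeta> *s u)) = (\<lambda>\<zeta>. koebe_factor k (\<zeta> * 1))" using u by (simp add: f_def)
    have "(deriv ^^ k) (\<lambda>\<zeta>. f (\<zeta> *s u)) 0 \<noteq> 0"
      using koebe_factor_slice_coeffs(1)[OF k, of 1] k unfolding slice by auto
    moreover have "(deriv ^^ k) (\<lambda>\<zeta>. f (\<zeta> *s u) - 1) 0 = (deriv ^^ k) (\<lambda>\<zeta>. f (\<zeta> *s u)) 0 - (deriv ^^ k) (\<lambda>\<zeta>. 1) 0"
    proof -
      obtain S where S: "open S" "0 \<in> S" "(\<lambda>\<zeta>. f (\<zeta> *s u)) holomorphic_on S"
        using slice_holomorphic_near_0[OF op \<Omega>0 f] by metis
      show ?thesis by (rule higher_deriv_diff[OF S(3) _ S(1,2)]) simp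
    qed
    ultimately have "(deriv ^^ k) (\<lambda>\<zeta>. f (\<zeta> *s u) - 1) 0 \<noteq> 0" using k by simp
    moreover have "u \<noteq> 0" using u by auto
    ultimately show ?thesis
      unfolding higher_deriv_scalar_times_id[OF op \<Omega>0 f1] by (simp add: vector_mul_eq_0 del: of_nat_Suc)
  qed
  have "zero_of_order (k + 1) (\<lambda>z. f z *s z - z)"
    unfolding zero_of_order_def eq
  proof (intro conjI exI[of _ "replicate (Suc k) u"] top)
    show "\<forall>j<k + 1. \<forall>hs. length hs = j \<longrightarrow> higher_deriv (\<lambda>z. (f z - 1) *s z) hs 0 = 0"
      using low by blast
    show "length (replicate (Suc k) u) = k + 1" by (simp only: length_replicate Suc_eq_plus1)
  qed
  then show ?thesis unfolding f_def .
qed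

lemma extremal_coeffs:
  fixes \<rho> :: "complex^'n \<Rightarrow> real"
  assumes dom: "starlike_circular_domain \<Omega> \<rho>" and \<Omega>0: "0 \<in> \<Omega>" and k: "k \<ge> 1"
    and le: "\<And>z. cmod (z $ i / a) \<le> \<rho> z"
    and diff: "\<rho> differentiable (at z)" and z: "z \<noteq> 0"
  defines "t \<equiv> z $ i / a / of_real (\<rho> z)" and "F \<equiv> \<lambda>z. koebe_factor k (z $ i / a) *s z"
  shows "(normalized_coeff \<rho> F (2 * k + 1) z)\<^sup>2 - (normalized_coeff \<rho> F (k + 1) z)\<^sup>2
    = t ^ (4 * k) * ((of_nat k + 2)\<^sup>2 / of_nat k ^ 4) + t ^ (2 * k) * (4 / (of_nat k)\<^sup>2)"
proof -
  define f where "f = (\<lambda>z :: complex^'n. koebe_factor k (z $ i / a))"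
  note f = extremal_facts(1)[OF dom k le, folded f_def]
  have pos: "\<rho> z > 0" using starlike_circular_domain_pos[OF dom z] .
  have t: "cmod t \<le> 1" using le[of z] pos unfolding t_def norm_divide[of "z $ i / a"] by simp
  have slice: "(\<lambda>\<zeta>. f (\<zeta> *s (of_real (1 / \<rho> z) *s z))) = (\<lambda>\<zeta>. koebe_factor k (\<zeta> * t))"
    by (simp add: f_def t_def mult_ac)
  have coeff: "normalized_coeff \<rho> F (m + 1) z = (deriv ^^ m) (\<lambda>\<zeta>. koebe_factor k (\<zeta> * t)) 0 / fact m" for m
    using normalized_coeff_scalar_times_id[OF dom \<Omega>0 f diff z, of m] unfolding slice by (simp add: F_def f_def)
  have "(\<i> * t ^ k)\<^sup>2 = - (t ^ (2 * k))" by (simp add: power_mult_distrib power_mult[symmetric] mult.commute)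
  moreover have "(t ^ (2 * k))\<^sup>2 = t ^ (4 * k)" by (simp flip: power_mult)
  ultimately show ?thesis
    unfolding coeff koebe_factor_slice_coeffs[OF k t]
    by (simp add: power_divide power_mult_distrib flip: power_mult)
qed

theorem theorem8:
  fixes \<Omega> :: "(complex^'n) set" and \<rho> :: "complex^'n \<Rightarrow> real"
    and E :: "(complex^'n) set" and k :: nat
  assumes "starlike_circular_domain \<Omega> \<rho>" and "0 \<in> \<Omega>"
    and "lower_dim_manifolds E" and "C1_on \<rho> (- E)"
    and "k \<ge> 1"
  shows
    "(\<forall>f F. holo_on (*) f \<Omega> \<and> F = (\<lambda>z. f z *s z) \<and> F \<in> starlike_mappings \<Omega> \<rho> E \<and>
        zero_of_order (k + 1) (\<lambda>z. F z - z) \<longrightarrow>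
        (\<forall>z\<in>\<Omega> - E.
           cmod ((normalized_coeff \<rho> F (2 * k + 1) z)\<^sup>2 - (normalized_coeff \<rho> F (k + 1) z)\<^sup>2)
             \<le> (real k + 2)\<^sup>2 / real k ^ 4 + 4 / (real k)\<^sup>2)) \<and>
     (\<forall>C. (\<forall>f F. holo_on (*) f \<Omega> \<and> F = (\<lambda>z. f z *s z) \<and> F \<in> starlike_mappings \<Omega> \<rho> E \<and>
        zero_of_order (k + 1) (\<lambda>z. F z - z) \<longrightarrow>
        (\<forall>z\<in>\<Omega> - E.
           cmod ((normalized_coeff \<rho> F (2 * k + 1) z)\<^sup>2 - (normalized_coeff \<rho> F (k + 1) z)\<^sup>2) \<le> C))
       \<longrightarrow> (real k + 2)\<^sup>2 / real k ^ 4 + 4 / (real k)\<^sup>2 \<le> C)"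
proof -
  note dom = assms(1) and \<Omega>0 = assms(2) and C1 = assms(4) and k = assms(5)
  note dense = closure_Compl_lower_dim_manifolds[OF assms(3)]
  let ?K = "(real k + 2)\<^sup>2 / real k ^ 4 + 4 / (real k)\<^sup>2"
  have "cmod ((normalized_coeff \<rho> F (2 * k + 1) z)\<^sup>2 - (normalized_coeff \<rho> F (k + 1) z)\<^sup>2) \<le> ?K"
    if "holo_on (*) f \<Omega>" "F = (\<lambda>z. f z *s z)" "F \<in> starlike_mappings \<Omega> \<rho> E"
      "zero_of_order (k + 1) (\<lambda>z. F z - z)" "z \<in> \<Omega> - E" for f F z
    using starlike_mapping_coeff_bounds[OF dom \<Omega>0 dense C1 k that(1) _ _ that(5)] that(3,4)
    unfolding that(2) by (intro norm_diff_squares_bound) blast+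
  moreover have "?K \<le> C"
    if C: "\<forall>f F. holo_on (*) f \<Omega> \<and> F = (\<lambda>z. f z *s z) \<and> F \<in> starlike_mappings \<Omega> \<rho> E \<and>
        zero_of_order (k + 1) (\<lambda>z. F z - z) \<longrightarrow>
        (\<forall>z\<in>\<Omega> - E.
           cmod ((normalized_coeff \<rho> F (2 * k + 1) z)\<^sup>2 - (normalized_coeff \<rho> F (k + 1) z)\<^sup>2) \<le> C)" for C
  proof (rule ccontr)
    assume "\<not> ?K \<le> C"
    obtain i u where u: "\<rho> u = 1" "u $ i \<noteq> 0" and le: "\<And>z. cmod (z $ i / u $ i) \<le> \<rho> z"
      using supporting_coordinate[OF dom] by blast
    define F where "F = (\<lambda>z. koebe_factor k (z $ i / u $ i) *s z)"
    have bound: "cmod ((normalized_coeff \<rho> F (2 * k + 1) z)\<^sup>2 - (normalized_coeff \<rho> F (k + 1) z)\<^sup>2) \<le> C"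
      if "z \<in> \<Omega> - E" for z
      using C[rule_format, OF conjI[OF extremal_facts(1)[OF dom k le] conjI[OF refl
          conjI[OF extremal_starlike[OF dom \<Omega>0 k C1 le] extremal_zero_of_order[OF dom \<Omega>0 k u(2) le]]]] that]
      unfolding F_def .
    define t where "t = (\<lambda>z. z $ i / u $ i / of_real (\<rho> z))"
    define V where "V = (\<lambda>z. cmod (t z ^ (4 * k) * ((of_nat k + 2)\<^sup>2 / of_nat k ^ 4)
        + t z ^ (2 * k) * (4 / (of_nat k)\<^sup>2)))"
    define U where "U = (\<Omega> - {0}) \<inter> V -` {C<..}"
    have op: "open \<Omega>" and cont: "continuous_on UNIV \<rho>"
      using dom unfolding starlike_circular_domain_def by blast+
    have "continuous_on (\<Omega> - {0}) V"
      unfolding V_def t_def using u(2) dom continuous_on_subset[OF cont]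
      by (intro continuous_intros) (auto simp: starlike_circular_domain_def)
    then have "open U"
      unfolding U_def by (intro continuous_open_preimage open_Diff op) auto
    moreover have "(1 / 2) *s u \<in> U"
    proof -
      have half: "\<rho> ((1 / 2) *s u) = 1 / 2"
        using starlike_circular_domain_scale[OF dom] u(1) by (simp add: norm_divide)
      have "(1 / 2) *s u \<in> \<Omega>" "t ((1 / 2) *s u) = 1"
        using starlike_circular_domain_iff[OF dom] u(2) by (simp_all add: t_def half)
      moreover have "u \<noteq> 0" using u(2) by auto
      moreover have "V ((1 / 2) *s u) = ?K"
      proof -
        have "V ((1 / 2) *s u) = cmod (of_real ?K)"
          unfolding V_def \<open>t ((1 / 2) *s u) = 1\<close> by simp
        also have "\<dots> = ?K" unfolding norm_of_real by simp
        finally show ?thesis .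
      qed
      ultimately show ?thesis
        using \<open>\<not> ?K \<le> C\<close> by (simp add: U_def vector_mul_eq_0)
    qed
    ultimately obtain y where y: "y \<in> U" "y \<notin> E" using dense_Compl_meets_open[OF dense] by blast
    then have y\<Omega>: "y \<in> \<Omega>" "y \<noteq> 0" and yV: "C < V y" by (auto simp: U_def)
    have diff: "\<rho> differentiable (at y)" using C1_on_imp_differentiable[OF C1] y(2) by blast
    have "(normalized_coeff \<rho> F (2 * k + 1) y)\<^sup>2 - (normalized_coeff \<rho> F (k + 1) y)\<^sup>2
      = t y ^ (4 * k) * ((of_nat k + 2)\<^sup>2 / of_nat k ^ 4) + t y ^ (2 * k) * (4 / (of_nat k)\<^sup>2)"
      unfolding F_def t_def by (rule extremal_coeffs[OF dom \<Omega>0 k le diff y\<Omega>(2)])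
    then have "V y \<le> C" using bound[of y] y\<Omega>(1) y(2) by (simp add: V_def)
    then show False using yV by simp
  qed
  ultimately show ?thesis by blast
qed

end
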